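(* Let $d\in\{3,5,7,\ldots\}$ be odd, so that $\nu:=(d-3)/2$ is a non-negative integer, let $\beta=1$, and let $s\in\mathbb{C}$ with $\operatorname{Re}s>0$ or $s\in\mathrm{i}\mathbb{R}\setminus\{0\}$. Let $G_{\mathrm{imp}}$ be the function on $H_+=\{\mathbf{z}\in\mathbb{R}^d: z_d>0\}$ defined in the context (for $\beta=1$). Then for all $\mathbf{z}\in H_+$: (a) If $d=3$ (i.e. $\nu=0$), \[ G_{\mathrm{imp}}(\mathbf{z})=-\frac{s}{2\pi}\,e^{-s\|\mathbf{z}\|}\,U\bigl(1,1,s(\|\mathbf{z}\|+z_3)\bigr), \] where $U(a,b,z)$ is Tricomi's confluent hypergeometric function. (b) If $\nu\in\{1,2,3,\ldots\}$, \[ G_{\mathrm{imp}}(\mathbf{z})=\left(s-\frac{\partial}{\partial z_d}\right)^{\nu-1}\Psi_{\nu,s}(\mathbf{z}), \qquad \Psi_{\nu,s}(\mathbf{z}):=-\frac{s}{(2\pi)^{\nu+1}}\,\frac{e^{-s\|\mathbf{z}\|}}{(\|\mathbf{z}\|+z_d)^{\nu}\,\|\mathbf{z}\|}. \]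
   Context: $\|\cdot\|$ is the Euclidean norm. For $\mathbf{z}\in\mathbb{R}^d$ write $\mathbf{z}'=(z_1,\ldots,z_{d-1})$. $K_\lambda$ is the modified Bessel function of the second kind (Macdonald function) of order $\lambda$. $U(a,b,z)$ is Tricomi's (confluent hypergeometric, Gordon) function, the standard solution of Kummer's differential equation (principal branch). Complex powers are principal branches (so $(s^2)^{\nu+1/2}=s^{2\nu+1}$ for $\operatorname{Re}s>0$). Definition of $G_{\mathrm{imp}}$ for $\beta=1$ and $\operatorname{Re}s>0$: for $\mathbf{z}\in H_+$ let $\mu(\mathbf{z}',t):=\sqrt{\|\mathbf{z}'\|^2+t^2}$ and \[ y(\mathbf{z},\cdot):[z_d,\infty)\to[0,\infty),\qquad y(\mathbf{z},t):=-(\|\mathbf{z}\|+z_d)+t+\mu(\mathbf{z}',t), \] a strictly increasing bijection with inverse $t(\mathbf{z},\cdot):[0,\infty)\to[z_d,\infty)$; set $\tilde\mu(\mathbf{z},y):=\mu(\mathbf{z}',t(\mathbf{z},y))$. With the abbreviations $t=t(\mathbf{z},y)$ and $\tilde\mu=\tilde\mu(\mathbf{z},y)$, \[ \psi_{\nu,s}(\mathbf{z}):=\int_0^\infty \frac{e^{-sy}}{t+\tilde\mu}\,\frac{e^{s\tilde\mu}K_{\nu+1/2}(s\tilde\mu)}{(s\tilde\mu)^{\nu-1/2}}\,dy, \qquad G_{\mathrm{imp}}(\mathbf{z}):=-\frac{1}{\pi}\left(\frac{s^2}{2\pi}\right)^{\nu+1/2}e^{-s\|\mathbf{z}\|}\,\psi_{\nu,s}(\mathbf{z}).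 \] For $s\in\mathrm{i}\mathbb{R}\setminus\{0\}$, $G_{\mathrm{imp}}(\mathbf{z})$ is defined as the limit, as $\sigma\to s$ with $\operatorname{Re}\sigma>0$, of the function just defined with $\sigma$ in place of $s$. *)

theory Defs
  imports "HOL-Complex_Analysis.Complex_Analysis"
begin

section \<open>Special functions\<close>

definition bessel_I :: "complex \<Rightarrow> complex \<Rightarrow> complex" where
  "bessel_I \<alpha> z =
     (z / 2) powr \<alpha> * (\<Sum>k. (z\<^sup>2 / 4) ^ k * rGamma (\<alpha> + of_nat k + 1) / fact k)"

text \<open>Macdonald's definition of the modified Bessel function of the second kind;
  at integer orders it is extended by continuity in the order.\<close>

definition bessel_K :: "complex \<Rightarrow> complex \<Rightarrow> complex" where
  "bessel_K \<alpha> z =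
     (let F = (\<lambda>\<alpha>'. of_real pi / 2 * (bessel_I (- \<alpha>') z - bessel_I \<alpha>' z) / sin (of_real pi * \<alpha>'))
      in if \<alpha> \<in> \<int> then Lim (at \<alpha>) F else F \<alpha>)"

text \<open>The principal branch of Tricomi's function is the solution \<open>f\<close> of Kummer's equation
  \<open>z f'' + (b - z) f' - a f = 0\<close> on the plane cut along the nonpositive reals that is
  asymptotic to \<open>z powr (- a)\<close> as \<open>z\<close> tends to infinity in each sector
  \<open>\<bar>Arg z\<bar> \<le> pi - \<delta>\<close>. Its values are only specified off the cut.\<close>

definition is_tricomi_U :: "complex \<Rightarrow> complex \<Rightarrow> (complex \<Rightarrow> complex) \<Rightarrow> bool" where
  "is_tricomi_U a b f \<longleftrightarrow>
     f holomorphic_on (- \<real>\<^sub>\<le>\<^sub>0) \<and>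
     (\<forall>z \<in> - \<real>\<^sub>\<le>\<^sub>0. z * deriv (deriv f) z + (b - z) * deriv f z - a * f z = 0) \<and>
     (\<forall>\<delta>>0. ((\<lambda>z. z powr a * f z) \<longlongrightarrow> 1)
        (inf at_infinity (principal {z. \<bar>Arg z\<bar> \<le> pi - \<delta>})))"

definition tricomi_U :: "complex \<Rightarrow> complex \<Rightarrow> complex \<Rightarrow> complex" where
  "tricomi_U a b z = (THE w. \<exists>f. is_tricomi_U a b f \<and> w = f z)"

section \<open>The function \<open>G_imp\<close> for \<open>\<beta> = 1\<close>\<close>

text \<open>Points of \<open>d\<close>-dimensional space are vectors in \<open>real ^ 'n\<close> with \<open>d = CARD('n)\<close>.
  The index \<open>l :: 'n\<close> is the one of the distinguished (last) coordinate \<open>z\<^sub>d\<close>.\<close>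

definition H_plus :: "'n \<Rightarrow> (real ^ 'n::finite) set" where
  "H_plus l = {z. z $ l > 0}"

text \<open>The vector \<open>z'\<close> of the remaining coordinates is kept in \<open>real ^ 'n\<close>, with \<open>0\<close> at
  position \<open>l\<close>; only its Euclidean norm is used.\<close>

definition tang :: "'n \<Rightarrow> real ^ 'n::finite \<Rightarrow> real ^ 'n" where
  "tang l z = (\<chi> i. if i = l then 0 else z $ i)"

definition mu :: "'n \<Rightarrow> real ^ 'n::finite \<Rightarrow> real \<Rightarrow> real" where
  "mu l z t = sqrt ((norm (tang l z))\<^sup>2 + t\<^sup>2)"

definition y_fun :: "'n \<Rightarrow> real ^ 'n::finite \<Rightarrow> real \<Rightarrow> real" where
  "y_fun l z t = - (norm z + z $ l) + t + mu l z t"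

definition t_fun :: "'n \<Rightarrow> real ^ 'n::finite \<Rightarrow> real \<Rightarrow> real" where
  "t_fun l z = the_inv_into {z $ l..} (y_fun l z)"

definition mu_tilde :: "'n \<Rightarrow> real ^ 'n::finite \<Rightarrow> real \<Rightarrow> real" where
  "mu_tilde l z y = mu l z (t_fun l z y)"

lemma norm_tang: "(norm (tang l z))\<^sup>2 + (z $ l)\<^sup>2 = (norm z)\<^sup>2"
proof -
  have 1: "(norm w)\<^sup>2 = (\<Sum>i\<in>UNIV. (w $ i)\<^sup>2)" for w :: "real ^ 'n"
    by (simp add: norm_vec_def L2_set_def sum_nonneg)
  have "(norm z)\<^sup>2 = (z $ l)\<^sup>2 + (\<Sum>i\<in>UNIV - {l}. (z $ i)\<^sup>2)"
    unfolding 1 by (rule sum.remove) auto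
  moreover have "(norm (tang l z))\<^sup>2 = (\<Sum>i\<in>UNIV - {l}. (z $ i)\<^sup>2)"
    unfolding 1 by (subst sum.remove[of _ l]) (auto simp: tang_def intro!: sum.cong)
  ultimately show ?thesis by simp
qed

lemma y_fun_strict_mono: "z \<in> H_plus l \<Longrightarrow> strict_mono_on {z $ l..} (y_fun l z)"
  by (auto simp: strict_mono_on_def H_plus_def y_fun_def mu_def
      intro!: add_less_le_mono power_mono)

lemma y_fun_bij:
  assumes "z \<in> H_plus l"
  shows "bij_betw (y_fun l z) {z $ l..} {0..}"
  unfolding bij_betw_def
proof
  show inj: "inj_on (y_fun l z) {z $ l..}"
    using y_fun_strict_mono[OF assms] by (rule strict_mono_on_imp_inj_on)
  have zl: "z $ l > 0" using assms by (simp add: H_plus_def)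
  have y0: "y_fun l z (z $ l) = 0"
    by (simp add: y_fun_def mu_def norm_tang)
  show "y_fun l z ` {z $ l..} = {0..}"
  proof (intro equalityI subsetI)
    fix y assume "y \<in> y_fun l z ` {z $ l..}"
    then obtain t where t: "t \<ge> z $ l" "y = y_fun l z t" by auto
    have "y_fun l z (z $ l) \<le> y_fun l z t"
      using strict_mono_on_leD[OF y_fun_strict_mono[OF assms], of "z $ l" t] t by auto
    then show "y \<in> {0..}" using t y0 by simp
  next
    fix y :: real assume "y \<in> {0..}"
    then have y: "y \<ge> 0" by simp
    have le: "y_fun l z (z $ l) \<le> y" using y0 y by simp
    have "mu l z t \<ge> 0" for t by (simp add: mu_def)
    then have ge: "y \<le> y_fun l z (z $ l + y + norm z)"
      by (simp add: y_fun_def)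
    have "continuous_on {z $ l..z $ l + y + norm z} (y_fun l z)"
      unfolding y_fun_def mu_def by (intro continuous_intros)
    then obtain t where "z $ l \<le> t" "y_fun l z t = y"
      using IVT'[of "y_fun l z" "z $ l" y "z $ l + y + norm z"] le ge y by auto
    then show "y \<in> y_fun l z ` {z $ l..}" by auto
  qed
qed

definition psi :: "real \<Rightarrow> complex \<Rightarrow> 'n \<Rightarrow> real ^ 'n::finite \<Rightarrow> complex" where
  "psi \<nu> s l z =
     (LINT y:{0..}|lborel.
        (let t = t_fun l z y; m = mu_tilde l z y
         in exp (- s * of_real y) / of_real (t + m) *
            (exp (s * of_real m) * bessel_K (of_real (\<nu> + 1/2)) (s * of_real m)
               / (s * of_real m) powr of_real (\<nu> - 1/2))))"

definition G_imp_rhp :: "complex \<Rightarrow> 'n \<Rightarrow> real ^ 'n::finite \<Rightarrow> complex" where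
  "G_imp_rhp s l z =
     (let \<nu> = (real CARD('n) - 3) / 2
      in - (1 / of_real pi) * (s\<^sup>2 / (2 * of_real pi)) powr of_real (\<nu> + 1/2)
           * exp (- s * of_real (norm z)) * psi \<nu> s l z)"

definition G_imp :: "complex \<Rightarrow> 'n \<Rightarrow> real ^ 'n::finite \<Rightarrow> complex" where
  "G_imp s l z =
     (if Re s > 0 then G_imp_rhp s l z
      else Lim (at s within {\<sigma>. Re \<sigma> > 0}) (\<lambda>\<sigma>. G_imp_rhp \<sigma> l z))"

section \<open>The differential expression\<close>

definition partial_deriv :: "'n \<Rightarrow> (real ^ 'n::finite \<Rightarrow> complex) \<Rightarrow> real ^ 'n \<Rightarrow> complex" where
  "partial_deriv l f z = vector_derivative (\<lambda>h. f (z + h *\<^sub>R axis l 1)) (at 0)"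

definition s_minus_partial ::
    "complex \<Rightarrow> 'n \<Rightarrow> (real ^ 'n::finite \<Rightarrow> complex) \<Rightarrow> real ^ 'n \<Rightarrow> complex" where
  "s_minus_partial s l f = (\<lambda>z. s * f z - partial_deriv l f z)"

definition Psi :: "nat \<Rightarrow> complex \<Rightarrow> 'n \<Rightarrow> real ^ 'n::finite \<Rightarrow> complex" where
  "Psi \<nu> s l z =
     - (s / (2 * of_real pi) ^ (\<nu> + 1)) *
       (exp (- s * of_real (norm z)) / of_real ((norm z + z $ l) ^ \<nu> * norm z))"

end

theory Submission
  imports Defs
begin

text \<open>With \<open>u = y + norm z + z $ l\<close> and \<open>r = (norm (tang l z))\<^sup>2\<close>, the substitution defining
  \<open>G_imp\<close> is explicit: \<open>t = (u - r / u) / 2\<close> and \<open>\<mu> = (u + r / u) / 2\<close>, with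
  \<open>dt/dy = \<mu> / u\<close> and \<open>d\<mu>/dy = t / u\<close>. In every case the integrand of \<open>\<psi>\<close> has an explicit
  antiderivative in \<open>y\<close>.

  For \<open>\<nu> = 0\<close>, \<open>U(1,1,w)\<close> is the integral \<open>F w\<close> of \<open>exp (- t) / (w + t)\<close> over
  \<open>t \<ge> 0\<close>. It satisfies \<open>F' = F - 1 / w\<close>, so \<open>- exp (- s y) F (s u)\<close> is an
  antiderivative of \<open>exp (- s y) / u\<close>, and no rotation of contours is needed.

  For \<open>\<nu> > 0\<close>, let \<open>P = - (1 / \<mu>) \<partial>/\<partial>\<mu>\<close> (with \<open>t\<close> fixed), \<open>D = s - d/dt\<close> along
  \<open>\<mu> = sqrt (r + t\<^sup>2)\<close>, and \<open>E b = exp (- s \<mu>) / (\<mu> (\<mu> + t) ^ b)\<close>. The operators commute and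
  \<open>D (E (b + 1)) = P (E b)\<close>, hence \<open>D ^ j (E (b + j)) = P ^ j (E b)\<close>. The Bessel factor of
  half-integer order is a multiple of \<open>P ^ \<nu> (E 0) = D ^ \<nu> (E \<nu>)\<close>, so the antiderivative is
  a multiple of \<open>exp (- s t) D ^ (\<nu> - 1) (E \<nu>)\<close>.

  All formulas are continuous in \<open>s\<close> up to the punctured imaginary axis.\<close>

section \<open>Improper integrals with exponential decay\<close>

lemma set_integrable_exp_minus:
  fixes c :: real
  assumes "c > 0"
  shows "set_integrable lborel {0..} (\<lambda>x. exp (- c * x))"
proof -
  have "(\<lambda>x. exp (- c * x)) absolutely_integrable_on {0..}"
    using assms by (intro nonnegative_absolutely_integrable_1 integrable_on_exp_minus_to_infinity) auto
  then show ?thesis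
    unfolding set_integrable_def by (subst (asm) integrable_completion) auto
qed

lemma set_integrable_exp_bound:
  fixes f :: "real \<Rightarrow> complex"
  assumes "c > 0" and cont: "continuous_on {0..} f"
    and bound: "\<And>x. x \<ge> 0 \<Longrightarrow> norm (f x) \<le> C * exp (- c * x)"
  shows "set_integrable lborel {0..} f"
proof (rule set_integrable_bound)
  show "set_integrable lborel {0..} (\<lambda>x. C * exp (- c * x))"
    using set_integrable_exp_minus[OF assms(1)] by simp
  show "set_borel_measurable lborel {0..} f"
    unfolding set_borel_measurable_def
    using borel_measurable_continuous_on_indicator[OF _ cont] by simp
  show "AE x in lborel. x \<in> {0..} \<longrightarrow> norm (f x) \<le> norm (C * exp (- c * x))"
    using bound by (intro AE_I2) (fastforce intro: order_trans)
qed

lemma set_integral_exp_bound: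
  fixes f :: "real \<Rightarrow> complex"
  assumes c: "c > 0" and cont: "continuous_on {0..} f"
    and bound: "\<And>x. x \<ge> 0 \<Longrightarrow> norm (f x) \<le> C * exp (- c * x)"
  shows "norm (LINT x:{0..}|lborel. f x) \<le> C * (LINT x:{0..}|lborel. exp (- c * x))"
proof -
  have int: "set_integrable lborel {0..} f"
    by (rule set_integrable_exp_bound[OF assms])
  have ex: "set_integrable lborel {0..} (\<lambda>x. C * exp (- c * x))"
    using set_integrable_exp_minus[OF c] by simp
  have "norm (LINT x:{0..}|lborel. f x) \<le> (LINT x:{0..}|lborel. norm (f x))"
    by (rule set_integral_norm_bound[OF int])
  also have "\<dots> \<le> (LINT x:{0..}|lborel. C * exp (- c * x))"
    using bound by (intro set_integral_mono set_integrable_norm[OF int] ex) auto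
  finally show ?thesis by simp
qed

text \<open>The exponential bound supplies integrability, so an antiderivative that vanishes at
  infinity determines the integral. The closed half-line exceeds the open interval of the interval
  integral only by the null set \<open>{0}\<close>.\<close>

lemma set_integral_FTC_to_infinity:
  fixes f F :: "real \<Rightarrow> complex"
  assumes "c > 0" and cont: "continuous_on {0..} f"
    and bound: "\<And>x. x \<ge> 0 \<Longrightarrow> norm (f x) \<le> C * exp (- c * x)"
    and deriv: "\<And>x. x \<ge> 0 \<Longrightarrow> (F has_vector_derivative f x) (at x)"
    and lim: "(F \<longlongrightarrow> 0) at_top"
  shows "(LINT x:{0..}|lborel. f x) = - F 0"
proof -
  have int: "set_integrable lborel {0..} f"
    by (rule set_integrable_exp_bound[OF assms(1-3)])
  have "(LINT x:{0..}|lborel. f x) = (LINT x:{0<..}|lborel. f x)"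
    unfolding set_lebesgue_integral_def
  proof (rule integral_cong_AE)
    have meas: "(\<lambda>x. indicator S x *\<^sub>R f x) \<in> borel_measurable lborel"
      if "S \<in> sets borel" "S \<subseteq> {0..}" for S
      using borel_measurable_continuous_on_indicator[OF that(1) continuous_on_subset[OF cont that(2)]]
      by simp
    show "(\<lambda>x. indicator {0..} x *\<^sub>R f x) \<in> borel_measurable lborel"
      "(\<lambda>x. indicator {0<..} x *\<^sub>R f x) \<in> borel_measurable lborel"
      by (rule meas; auto)+
    show "AE x in lborel. indicator {0..} x *\<^sub>R f x = indicator {0<..} x *\<^sub>R f x"
      using AE_lborel_singleton[of "0::real"] by eventually_elim (auto simp: indicator_def)
  qed
  also have "\<dots> = (LBINT x=ereal 0..\<infinity>. f x)"
    by (simp only: interval_integral_to_infinity_eq)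
  also have "\<dots> = 0 - F 0"
  proof (rule interval_integral_FTC_integrable[where F = F])
    show "isCont f x" if "ereal 0 < ereal x" for x
    proof -
      have "continuous_on {0<..} f" by (rule continuous_on_subset[OF cont]) auto
      then show ?thesis using that by (simp add: continuous_on_eq_continuous_at)
    qed
    show "set_integrable lborel (einterval (ereal 0) \<infinity>) f"
      by (rule set_integrable_subset[OF int]) (auto simp: einterval_def)
    have "isCont F 0"
      using deriv[of 0] has_vector_derivative_continuous by auto
    then have "(F \<longlongrightarrow> F 0) (at_right 0)"
      by (simp add: isCont_def filterlim_at_split)
    then show "((F \<circ> real_of_ereal) \<longlongrightarrow> F 0) (at_right (ereal 0))"
      by (simp only: ereal_tendsto_simps)
    show "((F \<circ> real_of_ereal) \<longlongrightarrow> 0) (at_left \<infinity>)"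
      using lim by (simp only: ereal_tendsto_simps)
  qed (use deriv in auto)
  finally show ?thesis by simp
qed

section \<open>Tricomi's function for \<open>a = b = 1\<close>\<close>

text \<open>This is \<open>exp z * E_1 z\<close> with the exponential integral \<open>E_1\<close>,
  written as a Stieltjes transform. The denominator can vanish only for \<open>z\<close> on the cut,
  so one formula serves the whole slit plane.\<close>

definition exp_stieltjes :: "complex \<Rightarrow> complex" where
  "exp_stieltjes z = (LINT t:{0..}|lborel. of_real (exp (- t)) / (z + of_real t))"

text \<open>A point \<open>w\<close> near \<open>z\<close> that were also near \<open>- t\<close>
  would put \<open>- t\<close>, a point of the cut, into a ball avoiding the cut. The bound is
  uniform in \<open>t\<close> and \<open>w\<close>, as domination of the kernels below
  requires.\<close>

lemma slit_lower_bound: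
  fixes z :: complex
  assumes "z \<in> - \<real>\<^sub>\<le>\<^sub>0"
  obtains m where "m > 0" "\<And>t w. t \<ge> 0 \<Longrightarrow> dist w z < m \<Longrightarrow> norm (w + of_real t) \<ge> m"
proof -
  have "open (- \<real>\<^sub>\<le>\<^sub>0 :: complex set)"
    by (simp add: open_Compl closed_nonpos_Reals_complex)
  then obtain e where e: "e > 0" "ball z e \<subseteq> - \<real>\<^sub>\<le>\<^sub>0"
    using assms by (rule openE)
  have "norm (w + of_real t) \<ge> e / 2" if "t \<ge> 0" "dist w z < e / 2" for t w
  proof (rule ccontr)
    assume "\<not> ?thesis"
    then have "dist w (- of_real t) < e / 2" by (simp add: dist_norm)
    then have "dist z (- of_real t) < e / 2 + e / 2"
      using that(2) by (intro dist_triangle_less_add[of z w]) (simp_all add: dist_commute)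
    then have "- of_real t \<in> ball z e" by simp
    moreover have "- of_real t \<in> (\<real>\<^sub>\<le>\<^sub>0 :: complex set)"
      using that(1) by (simp flip: of_real_minus)
    ultimately show False using e by auto
  qed
  then show thesis using that[of "e / 2"] e by auto
qed

lemma slit_add_nonneg_neq_0:
  fixes z :: complex
  assumes "z \<in> - \<real>\<^sub>\<le>\<^sub>0" "t \<ge> 0"
  shows "z + of_real t \<noteq> 0"
  using assms by (metis ComplD add_eq_0_iff2 nonpos_Reals_of_real_iff neg_le_0_iff_le of_real_minus)

text \<open>Differentiation under the integral is carried out by hand: the error of the difference
  quotient is \<open>w - z\<close> times an integral bounded uniformly near \<open>z\<close>.
  Integration by parts then rewrites the derivative \<open>- J\<close>.\<close>

lemma has_field_derivative_exp_stieltjes: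
  assumes z: "z \<in> - \<real>\<^sub>\<le>\<^sub>0"
  shows "(exp_stieltjes has_field_derivative exp_stieltjes z - 1 / z) (at z)"
proof -
  obtain m where m: "m > 0"
    "\<And>t w. t \<ge> 0 \<Longrightarrow> dist w z < m \<Longrightarrow> norm (w + of_real t) \<ge> m"
    using slit_lower_bound[OF z] by blast
  have nz: "w + of_real t \<noteq> 0" if "t \<ge> 0" "dist w z < m" for w t
    using m(2)[OF that] m(1) by auto
  \<comment> \<open>Up to sign, \<open>?h w v\<close> is the first divided difference of the
    integrand in its complex argument; \<open>?g w v\<close> is the second one, with node
    \<open>v\<close> repeated.\<close>
  let ?h = "\<lambda>w v t. of_real (exp (- t)) / ((w + of_real t) * (v + of_real t)) :: complex"
  let ?g = "\<lambda>w v t. of_real (exp (- t)) / ((w + of_real t) * (v + of_real t)\<^sup>2) :: complex"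
  have int1: "set_integrable lborel {0..} (\<lambda>t. of_real (exp (- t)) / (w + of_real t))"
    if "dist w z < m" for w
  proof (rule set_integrable_exp_bound[where c = 1 and C = "1 / m"])
    show "continuous_on {0..} (\<lambda>t. of_real (exp (- t)) / (w + of_real t))"
      using nz that by (intro continuous_intros) auto
    show "norm (of_real (exp (- t)) / (w + of_real t)) \<le> 1 / m * exp (- 1 * t)" if "t \<ge> 0" for t
      using m(2)[of t w] m(1) that \<open>dist w z < m\<close> by (simp add: norm_divide divide_left_mono mult_pos_pos frac_le)
  qed simp
  have int2: "set_integrable lborel {0..} (?h w v)"
    if "dist w z < m" "dist v z < m" for w v
  proof (rule set_integrable_exp_bound[where c = 1 and C = "1 / (m * m)"])
    show "continuous_on {0..} (?h w v)"
      using nz that by (intro continuous_intros) auto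
    show "norm (?h w v t) \<le> 1 / (m * m) * exp (- 1 * t)" if "t \<ge> 0" for t
    proof -
      have "m * m \<le> norm (w + of_real t) * norm (v + of_real t)"
        using m(1) m(2)[of t w] m(2)[of t v] that \<open>dist w z < m\<close> \<open>dist v z < m\<close>
        by (intro mult_mono) auto
      then show ?thesis using m(1) by (simp add: norm_divide norm_mult frac_le)
    qed
  qed simp
  have cont3: "continuous_on {0..} (?g w z)" if "dist w z < m" for w
    using nz that m(1) by (intro continuous_intros) auto
  have bound3: "norm (?g w z t) \<le> 1 / (m * m\<^sup>2) * exp (- 1 * t)" if "t \<ge> 0" "dist w z < m" for t w
  proof -
    have "m * m\<^sup>2 \<le> norm (w + of_real t) * (norm (z + of_real t))\<^sup>2"
      using m(1) m(2)[of t w] m(2)[of t z] that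
      by (intro mult_mono power_mono) auto
    then show ?thesis using m(1) by (simp add: norm_divide norm_mult norm_power frac_le)
  qed
  define K where "K = 1 / (m * m\<^sup>2) * (LINT x:{0..}|lborel. exp (- 1 * x))"
  define J where "J = (LINT t:{0..}|lborel. ?h z z t)"
  have quot: "norm ((exp_stieltjes w - exp_stieltjes z) / (w - z) - (- J)) \<le> norm (w - z) * K"
    if w: "w \<noteq> z" "dist w z < m" for w
  proof -
    have "exp_stieltjes w - exp_stieltjes z =
        (LINT t:{0..}|lborel. of_real (exp (- t)) / (w + of_real t) - of_real (exp (- t)) / (z + of_real t))"
      unfolding exp_stieltjes_def using int1 w m(1) by (intro set_integral_diff(2)[symmetric]) auto
    also have "\<dots> = (LINT t:{0..}|lborel. (w - z) * - ?h w z t)"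
    proof (rule set_lebesgue_integral_cong, simp, intro allI impI)
      fix t :: real assume "t \<in> {0..}"
      then have "w + of_real t \<noteq> 0" "z + of_real t \<noteq> 0" using nz w m(1) by auto
      then show "of_real (exp (- t)) / (w + of_real t) - of_real (exp (- t)) / (z + of_real t) =
          (w - z) * - ?h w z t"
        by (simp add: divide_simps) (simp add: algebra_simps)
    qed
    also have "\<dots> = (w - z) * (LINT t:{0..}|lborel. - ?h w z t)"
      by (rule set_integral_mult_right)
    finally have "(exp_stieltjes w - exp_stieltjes z) / (w - z) - (- J)
        = J + (LINT t:{0..}|lborel. - ?h w z t)"
      using w by simp
    also have "\<dots> = J - (LINT t:{0..}|lborel. ?h w z t)"
      using int2[of w z] w m(1) by (simp add: set_integral_uminus)
    also have "\<dots> = (LINT t:{0..}|lborel. ?h z z t - ?h w z t)"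
      unfolding J_def using int2 w m(1) by (intro set_integral_diff(2)[symmetric]) auto
    also have "\<dots> = (LINT t:{0..}|lborel. (w - z) * ?g w z t)"
    proof (rule set_lebesgue_integral_cong, simp, intro allI impI)
      fix t :: real assume "t \<in> {0..}"
      then have "w + of_real t \<noteq> 0" "z + of_real t \<noteq> 0" using nz w m(1) by auto
      then show "?h z z t - ?h w z t = (w - z) * ?g w z t"
        by (simp add: divide_simps power2_eq_square) (simp add: algebra_simps)
    qed
    also have "\<dots> = (w - z) * (LINT t:{0..}|lborel. ?g w z t)" by (rule set_integral_mult_right)
    finally have eq: "(exp_stieltjes w - exp_stieltjes z) / (w - z) - (- J)
      = (w - z) * (LINT t:{0..}|lborel. ?g w z t)" .
    have "norm (LINT t:{0..}|lborel. ?g w z t) \<le> K"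
      unfolding K_def using bound3 w by (intro set_integral_exp_bound cont3) auto
    then show ?thesis
      unfolding eq norm_mult by (intro mult_left_mono) auto
  qed
  have "((\<lambda>w. (exp_stieltjes w - exp_stieltjes z) / (w - z)) \<longlongrightarrow> - J) (at z)"
  proof (rule LIM_zero_cancel, rule Lim_null_comparison)
    show "\<forall>\<^sub>F w in at z. norm ((exp_stieltjes w - exp_stieltjes z) / (w - z) - (- J)) \<le> norm (w - z) * K"
      using quot m(1) by (auto simp: eventually_at)
    show "((\<lambda>w. norm (w - z) * K) \<longlongrightarrow> 0) (at z)"
      by (auto intro!: tendsto_eq_intros)
  qed
  then have "(exp_stieltjes has_field_derivative - J) (at z)"
    by (simp add: has_field_derivative_iff)
  \<comment> \<open>The combined integrand is the derivative of
    \<open>- exp (- t) / (z + t)\<close>, which equals \<open>- 1 / z\<close> at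
    \<open>t = 0\<close>.\<close>
  moreover have "J + exp_stieltjes z = 1 / z"
  proof -
    have "J + exp_stieltjes z =
        (LINT t:{0..}|lborel. ?h z z t + of_real (exp (- t)) / (z + of_real t))"
      unfolding J_def exp_stieltjes_def using int1 int2 m(1)
      by (intro set_integral_add(2)[symmetric]) auto
    also have "\<dots> = - (- (of_real (exp (- 0)) / (z + of_real 0)))"
    proof (rule set_integral_FTC_to_infinity[where c = 1 and C = "1 / (m * m) + 1 / m"
            and F = "\<lambda>t. - (of_real (exp (- t)) / (z + of_real t))"])
      show "continuous_on {0..} (\<lambda>t. ?h z z t + of_real (exp (- t)) / (z + of_real t))"
        using nz m(1) by (intro continuous_intros) auto
    next
      fix t :: real assume t: "t \<ge> 0"
      have "m * m \<le> norm (z + of_real t) * norm (z + of_real t)"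
        using m(1) m(2)[of t z] t by (intro mult_mono) auto
      then have "norm (?h z z t) \<le> 1 / (m * m) * exp (- t)"
        using m(1) by (simp add: norm_divide norm_mult frac_le)
      moreover have "norm (of_real (exp (- t)) / (z + of_real t)) \<le> 1 / m * exp (- t)"
        using m(2)[of t z] m(1) t by (simp add: norm_divide frac_le)
      ultimately have "norm (?h z z t + of_real (exp (- t)) / (z + of_real t))
          \<le> 1 / (m * m) * exp (- t) + 1 / m * exp (- t)"
        by (rule norm_triangle_mono)
      then show "norm (?h z z t + of_real (exp (- t)) / (z + of_real t))
          \<le> (1 / (m * m) + 1 / m) * exp (- 1 * t)"
        by (simp add: ring_distribs)
      have "z + of_real t \<noteq> 0" using nz t m(1) by simp
      then have "((\<lambda>w. - (exp (- w) / (z + w))) has_field_derivative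
          exp (- of_real t) / ((z + of_real t) * (z + of_real t)) + exp (- of_real t) / (z + of_real t))
          (at (of_real t))"
        by (auto intro!: derivative_eq_intros simp: divide_simps)
      from has_vector_derivative_real_field[OF this]
      show "((\<lambda>t. - (of_real (exp (- t)) / (z + of_real t))) has_vector_derivative
          (?h z z t + of_real (exp (- t)) / (z + of_real t))) (at t)"
        by (simp only: exp_of_real flip: of_real_minus)
    next
      have "((\<lambda>t. exp (- t) / m) \<longlongrightarrow> 0) at_top"
        using m(1) by real_asymp
      moreover have "\<forall>\<^sub>F t in at_top. norm (- (of_real (exp (- t)) / (z + of_real t))) \<le> exp (- t) / m"
        using eventually_ge_at_top[of 0]
      proof eventually_elim
        case (elim t)
        then show ?case
          using m(2)[of t z] m(1) by (simp add: norm_divide frac_le)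
      qed
      ultimately show "((\<lambda>t. - (of_real (exp (- t)) / (z + of_real t))) \<longlongrightarrow> 0) at_top"
        by (rule Lim_null_comparison[rotated])
    qed simp
    finally show ?thesis by simp
  qed
  ultimately show ?thesis by (metis add_diff_cancel_right' minus_diff_eq)
qed

lemma holomorphic_exp_stieltjes: "exp_stieltjes holomorphic_on (- \<real>\<^sub>\<le>\<^sub>0)"
  using has_field_derivative_exp_stieltjes
  by (auto simp: holomorphic_on_open open_Compl closed_nonpos_Reals_complex)

text \<open>A second use of \<open>F' = F - 1 / z\<close> gives \<open>F'' = F' + 1 / z^2\<close>,
  after which Kummer's equation for \<open>a = b = 1\<close> is an algebraic identity.\<close>

lemma exp_stieltjes_kummer:
  assumes z: "z \<in> - \<real>\<^sub>\<le>\<^sub>0"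
  shows "z * deriv (deriv exp_stieltjes) z + (1 - z) * deriv exp_stieltjes z - exp_stieltjes z = 0"
proof -
  have z0: "z \<noteq> 0" using z by auto
  have d: "deriv exp_stieltjes w = exp_stieltjes w - 1 / w" if "w \<in> - \<real>\<^sub>\<le>\<^sub>0" for w
    using has_field_derivative_exp_stieltjes[OF that] by (rule DERIV_imp_deriv)
  have "((\<lambda>w. exp_stieltjes w - 1 / w) has_field_derivative exp_stieltjes z - 1 / z + 1 / z\<^sup>2) (at z)"
    using z0 by (auto intro!: derivative_eq_intros has_field_derivative_exp_stieltjes z
        simp: power2_eq_square)
  then have "(deriv exp_stieltjes has_field_derivative exp_stieltjes z - 1 / z + 1 / z\<^sup>2) (at z)"
    by (rule has_field_derivative_transform_within_open[where S = "- \<real>\<^sub>\<le>\<^sub>0"])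
       (use z d in \<open>auto simp: open_Compl closed_nonpos_Reals_complex\<close>)
  then have "deriv (deriv exp_stieltjes) z = exp_stieltjes z - 1 / z + 1 / z\<^sup>2"
    by (rule DERIV_imp_deriv)
  then show ?thesis
    unfolding d[OF z] using z0 by (simp add: field_simps power2_eq_square)
qed

text \<open>In the law of cosines for \<open>norm (z + t)\<close>, the sector condition bounds the
  cross term below by its value on the extreme ray.\<close>

lemma norm_add_nonneg_sector_ge:
  assumes \<delta>: "0 < \<delta>" "\<delta> \<le> pi / 2" and z: "\<bar>Arg z\<bar> \<le> pi - \<delta>" and t: "t \<ge> 0"
  shows "sqrt (1 - cos \<delta>) * norm z \<le> norm (z + of_real t)"
proof -
  define r where "r = norm z"
  have "cos (pi - \<delta>) \<le> cos \<bar>Arg z\<bar>"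
    using z \<delta> by (intro cos_monotone_0_pi_le) auto
  then have c: "- cos \<delta> \<le> cos (Arg z)" by (simp add: abs_if split: if_splits)
  have cd: "0 \<le> cos \<delta>" "cos \<delta> \<le> 1"
    using \<delta> by (auto intro: cos_ge_zero)
  have r: "r \<ge> 0" by (simp add: r_def)
  have Re: "Re z = r * cos (Arg z)"
    unfolding r_def by (metis Re_rcis rcis_cmod_Arg)
  have "norm (z + of_real t) ^ 2 = r\<^sup>2 + 2 * t * Re z + t\<^sup>2"
    unfolding r_def cmod_power2 by (simp add: power2_eq_square algebra_simps)
  also have "\<dots> \<ge> r\<^sup>2 + 2 * t * (r * (- cos \<delta>)) + t\<^sup>2"
    unfolding Re using c r t by (intro add_mono mult_left_mono) auto
  \<comment> \<open>Since \<open>\<delta> \<le> pi / 2\<close>, \<open>cos \<delta>\<close> lies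
    between 0 and 1 and all three terms are nonnegative; the last one is the bound.\<close>
  also have "r\<^sup>2 + 2 * t * (r * (- cos \<delta>)) + t\<^sup>2 =
      cos \<delta> * (r - t)\<^sup>2 + (1 - cos \<delta>) * t\<^sup>2 + (1 - cos \<delta>) * r\<^sup>2"
    by (simp add: power2_eq_square algebra_simps)
  finally have "(1 - cos \<delta>) * r\<^sup>2 \<le> norm (z + of_real t) ^ 2"
    using cd by (smt (verit) mult_nonneg_nonneg zero_le_power2)
  then have "sqrt ((1 - cos \<delta>) * r\<^sup>2) \<le> sqrt (norm (z + of_real t) ^ 2)"
    by (rule real_sqrt_le_mono)
  then show ?thesis
    using r by (simp add: real_sqrt_mult r_def)
qed

text \<open>As \<open>exp (- t)\<close> has integral 1, \<open>z * F z - 1\<close> is minus the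
  integral of \<open>t * exp (- t) / (z + t)\<close>; the sector estimate of the denominator makes
  this \<open>O(1 / norm z)\<close>.\<close>

lemma norm_exp_stieltjes_asymp:
  assumes \<delta>: "0 < \<delta>" "\<delta> \<le> pi / 2" and z: "\<bar>Arg z\<bar> \<le> pi - \<delta>" "z \<noteq> 0"
  shows "norm (z * exp_stieltjes z - 1) \<le>
    (LINT x:{0..}|lborel. exp (- (1 / 2) * x)) * 2 / sqrt (1 - cos \<delta>) / norm z"
proof -
  define c where "c = sqrt (1 - cos \<delta>)"
  have "cos \<delta> < 1"
    using \<delta> cos_monotone_0_pi[of 0 \<delta>] by auto
  then have c: "c > 0" by (simp add: c_def)
  have lb: "c * norm z \<le> norm (z + of_real t)" if "t \<ge> 0" for t
    unfolding c_def by (rule norm_add_nonneg_sector_ge[OF \<delta> z(1) that])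
  have cz: "c * norm z > 0" using c z by simp
  have nz: "z + of_real t \<noteq> 0" if "t \<ge> 0" for t
    using lb[OF that] cz by auto
  \<comment> \<open>Half of the exponential decay is spent on absorbing the factor
    \<open>t\<close>.\<close>
  have texp: "t * exp (- t) \<le> 2 * exp (- (1 / 2) * t)" for t :: real
  proof -
    have "t / 2 \<le> exp (t / 2)" using exp_ge_add_one_self[of "t / 2"] by linarith
    then have "t / 2 * exp (- t) \<le> exp (t / 2) * exp (- t)" by (intro mult_right_mono) auto
    also have "\<dots> = exp (- (1 / 2) * t)" by (simp flip: exp_add)
    finally show ?thesis by simp
  qed
  have e1: "(LINT t:{0..}|lborel. complex_of_real (exp (- t))) = 1"
  proof -
    have "(LINT t:{0..}|lborel. complex_of_real (exp (- t))) = - (- of_real (exp (- 0)))"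
    proof (rule set_integral_FTC_to_infinity[where c = 1 and C = 1])
      show "((\<lambda>t. - complex_of_real (exp (- t))) has_vector_derivative of_real (exp (- t))) (at t)" for t
        by (auto intro!: derivative_eq_intros)
      have "((\<lambda>t. - complex_of_real (exp (- t))) \<longlongrightarrow> - of_real 0) at_top"
        by (intro tendsto_intros) real_asymp
      then show "((\<lambda>t. - complex_of_real (exp (- t))) \<longlongrightarrow> 0) at_top" by simp
    qed (auto intro!: continuous_intros)
    then show ?thesis by simp
  qed
  have "z * exp_stieltjes z = (LINT t:{0..}|lborel. z * (of_real (exp (- t)) / (z + of_real t)))"
    by (simp only: exp_stieltjes_def set_integral_mult_right)
  moreover have "set_integrable lborel {0..} (\<lambda>t. z * (of_real (exp (- t)) / (z + of_real t)))"
  proof (rule set_integrable_exp_bound[where c = 1 and C = "1 / c"])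
    show "continuous_on {0..} (\<lambda>t. z * (of_real (exp (- t)) / (z + of_real t)))"
      using nz by (intro continuous_intros) auto
    show "norm (z * (of_real (exp (- t)) / (z + of_real t))) \<le> 1 / c * exp (- 1 * t)" if "t \<ge> 0" for t
    proof -
      have "norm z / norm (z + of_real t) \<le> 1 / c"
        using lb[OF that] c nz[OF that] by (simp add: field_simps)
      then have "norm z / norm (z + of_real t) * exp (- t) \<le> 1 / c * exp (- t)"
        by (intro mult_right_mono) auto
      then show ?thesis by (simp add: norm_mult norm_divide)
    qed
  qed simp
  moreover have "set_integrable lborel {0..} (\<lambda>t. complex_of_real (exp (- t)))"
    by (rule set_integrable_exp_bound[where c = 1 and C = 1]) (auto intro!: continuous_intros)
  ultimately have "z * exp_stieltjes z - 1 = (LINT t:{0..}|lborel.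
      z * (of_real (exp (- t)) / (z + of_real t)) - of_real (exp (- t)))"
    unfolding e1[symmetric] by (simp add: set_integral_diff(2))
  also have "\<dots> = (LINT t:{0..}|lborel. - (of_real (t * exp (- t)) / (z + of_real t)))"
  proof (rule set_lebesgue_integral_cong, simp, intro allI impI)
    fix t :: real assume "t \<in> {0..}"
    then have "z + of_real t \<noteq> 0" using nz by simp
    then show "z * (of_real (exp (- t)) / (z + of_real t)) - of_real (exp (- t)) =
        - (of_real (t * exp (- t)) / (z + of_real t))"
      by (simp add: field_simps)
  qed
  also have "norm \<dots> \<le> 2 / (c * norm z) * (LINT x:{0..}|lborel. exp (- (1 / 2) * x))"
  proof (rule set_integral_exp_bound)
    show "continuous_on {0..} (\<lambda>t. - (of_real (t * exp (- t)) / (z + of_real t)))"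
      using nz by (intro continuous_intros) auto
    show "norm (- (of_real (t * exp (- t)) / (z + of_real t)))
        \<le> 2 / (c * norm z) * exp (- (1 / 2) * t)" if "t \<ge> 0" for t
    proof -
      have "t * exp (- t) / norm (z + of_real t) \<le> 2 * exp (- (1 / 2) * t) / (c * norm z)"
        using texp[of t] lb[OF that] cz by (intro frac_le) auto
      then show ?thesis using that by (simp add: norm_divide norm_mult)
    qed
  qed simp
  finally show ?thesis by (simp add: c_def field_simps)
qed

lemma is_tricomi_U_exp_stieltjes: "is_tricomi_U 1 1 exp_stieltjes"
  unfolding is_tricomi_U_def
proof (intro conjI ballI allI impI)
  fix \<delta> :: real assume \<delta>: "\<delta> > 0"
  \<comment> \<open>The sector estimate is available for angles up to \<open>pi / 2\<close>;
    shrinking \<open>\<delta>\<close> only enlarges the sector.\<close>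
  define \<delta>' where "\<delta>' = min \<delta> (pi / 2)"
  have \<delta>': "0 < \<delta>'" "\<delta>' \<le> pi / 2" "\<delta>' \<le> \<delta>" using \<delta> by (auto simp: \<delta>'_def)
  define M where "M = (LINT x:{0..}|lborel. exp (- (1 / 2) * x)) * 2 / sqrt (1 - cos \<delta>')"
  let ?F = "inf at_infinity (principal {z. \<bar>Arg z\<bar> \<le> pi - \<delta>})"
  show "((\<lambda>z. z powr 1 * exp_stieltjes z) \<longlongrightarrow> 1) ?F"
  proof (rule LIM_zero_cancel, rule Lim_null_comparison)
    have "\<forall>\<^sub>F z::complex in at_infinity. z \<noteq> 0"
      by (rule eventually_not_equal_at_infinity)
    then show "\<forall>\<^sub>F z in ?F. norm (z powr 1 * exp_stieltjes z - 1) \<le> M / norm z"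
      unfolding eventually_inf_principal
    proof eventually_elim
      case (elim z)
      show ?case
        using norm_exp_stieltjes_asymp[OF \<delta>'(1,2), of z] elim \<delta>'(3)
        by (auto simp: M_def powr_to_1)
    qed
    have "((\<lambda>z::complex. M / norm z) \<longlongrightarrow> 0) at_infinity"
      by (intro tendsto_divide_0[OF tendsto_const] filterlim_at_top_imp_at_infinity
          filterlim_norm_at_top)
    then show "((\<lambda>z::complex. M / norm z) \<longlongrightarrow> 0) ?F"
      by (rule tendsto_mono[rotated]) simp
  qed
qed (use holomorphic_exp_stieltjes exp_stieltjes_kummer in auto)

section \<open>Uniqueness of Tricomi's solution for \<open>a = b = 1\<close>\<close>

lemma is_tricomi_U_1_1_tendsto_real:
  assumes "is_tricomi_U 1 1 f"
  shows "((\<lambda>x. of_real x * f (of_real x)) \<longlongrightarrow> 1) at_top"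
proof -
  \<comment> \<open>For \<open>\<delta> = pi / 2\<close> the sector is the closed right half-plane,
    which contains the positive reals.\<close>
  have "filterlim complex_of_real (inf at_infinity (principal {z. \<bar>Arg z\<bar> \<le> pi - pi / 2})) at_top"
    unfolding filterlim_inf
  proof
    show "filterlim complex_of_real at_infinity at_top"
      by (simp add: filterlim_at_infinity_conv_norm_at_top filterlim_abs_real)
    have "\<forall>\<^sub>F x in at_top. complex_of_real x \<in> {z. \<bar>Arg z\<bar> \<le> pi - pi / 2}"
      using eventually_gt_at_top[of "0::real"] by eventually_elim auto
    then show "filterlim complex_of_real (principal {z. \<bar>Arg z\<bar> \<le> pi - pi / 2}) at_top"
      by (simp add: filterlim_principal)
  qed
  moreover have "((\<lambda>z. z powr 1 * f z) \<longlongrightarrow> 1)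
      (inf at_infinity (principal {z. \<bar>Arg z\<bar> \<le> pi - pi / 2}))"
    using assms pi_half_gt_zero unfolding is_tricomi_U_def by blast
  ultimately have "((\<lambda>x. of_real x powr 1 * f (of_real x)) \<longlongrightarrow> 1) at_top"
    by (rule filterlim_compose[rotated])
  then show ?thesis by (simp add: powr_to_1)
qed

lemma connected_slit_plane: "connected (- \<real>\<^sub>\<le>\<^sub>0 :: complex set)"
proof -
  have "(\<real>\<^sub>\<le>\<^sub>0 :: complex set) = complex_of_real ` {..0}"
    by (auto elim: nonpos_Reals_cases)
  then show ?thesis
    using starlike_slotted_complex_plane_left[of 0] starlike_imp_connected by metis
qed

text \<open>For \<open>a = b = 1\<close> Kummer's equation is exact: its left side is the derivative
  of \<open>w * (f' - f)\<close>. Hence \<open>f' = f + c / w\<close>, and variation of constants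
  gives \<open>f = d * exp w - c * F\<close> with \<open>F\<close> the Stieltjes integral. The
  behaviour along the positive reals forces \<open>d = 0\<close> and then
  \<open>c = - 1\<close>.\<close>

lemma is_tricomi_U_1_1_unique:
  assumes f: "is_tricomi_U 1 1 f" and z: "z \<in> - \<real>\<^sub>\<le>\<^sub>0"
  shows "f z = exp_stieltjes z"
proof -
  let ?S = "- \<real>\<^sub>\<le>\<^sub>0 :: complex set"
  have opS: "open ?S" by (simp add: open_Compl closed_nonpos_Reals_complex)
  have hol: "f holomorphic_on ?S" using f by (simp add: is_tricomi_U_def)
  have df: "(f has_field_derivative deriv f w) (at w)" if "w \<in> ?S" for w
    by (rule holomorphic_derivI[OF hol opS that])
  have ddf: "(deriv f has_field_derivative deriv (deriv f) w) (at w)" if "w \<in> ?S" for w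
    by (rule holomorphic_derivI[OF holomorphic_deriv[OF hol opS] opS that])
  have ode: "w * deriv (deriv f) w + (1 - w) * deriv f w - f w = 0" if "w \<in> ?S" for w
    using f that by (simp add: is_tricomi_U_def)
  have "(\<lambda>w. w * (deriv f w - f w)) constant_on ?S"
  proof (rule has_field_derivative_0_imp_constant_on[OF _ connected_slit_plane opS])
    fix w assume w: "w \<in> ?S"
    have "((\<lambda>w. w * (deriv f w - f w)) has_field_derivative
        (deriv f w - f w) + w * (deriv (deriv f) w - deriv f w)) (at w)"
      using df[OF w] ddf[OF w] by (auto intro!: derivative_eq_intros)
    moreover have "(deriv f w - f w) + w * (deriv (deriv f) w - deriv f w) = 0"
      using ode[OF w] by (simp add: algebra_simps)
    ultimately show "((\<lambda>w. w * (deriv f w - f w)) has_field_derivative 0) (at w)" by simp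
  qed
  then obtain c where c: "\<And>w. w \<in> ?S \<Longrightarrow> w * (deriv f w - f w) = c"
    unfolding constant_on_def by blast
  have "(\<lambda>w. exp (- w) * (f w + c * exp_stieltjes w)) constant_on ?S"
  proof (rule has_field_derivative_0_imp_constant_on[OF _ connected_slit_plane opS])
    fix w assume w: "w \<in> ?S"
    then have w0: "w \<noteq> 0" by auto
    have "deriv f w = f w + c / w" using c[OF w] w0 by (simp add: field_simps)
    then have "(f has_field_derivative f w + c / w) (at w)" using df[OF w] by simp
    then show "((\<lambda>w. exp (- w) * (f w + c * exp_stieltjes w)) has_field_derivative 0) (at w)"
      using has_field_derivative_exp_stieltjes[OF w]
      by (auto intro!: derivative_eq_intros simp: algebra_simps)
  qed
  then obtain d where d: "\<And>w. w \<in> ?S \<Longrightarrow> exp (- w) * (f w + c * exp_stieltjes w) = d"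
    unfolding constant_on_def by blast
  note lim = is_tricomi_U_1_1_tendsto_real[OF f]
    is_tricomi_U_1_1_tendsto_real[OF is_tricomi_U_exp_stieltjes]
  have lim1: "((\<lambda>x. of_real x * (f (of_real x) + c * exp_stieltjes (of_real x))) \<longlongrightarrow> 1 + c * 1) at_top"
    using tendsto_add[OF lim(1) tendsto_mult[OF tendsto_const[of c] lim(2)]]
    by (simp add: algebra_simps)
  have "((\<lambda>x. complex_of_real (exp (- x) / x)) \<longlongrightarrow> of_real 0) at_top"
    by (intro tendsto_of_real) real_asymp
  \<comment> \<open>For \<open>x > 0\<close> this product is the constant \<open>d\<close>, yet it
    tends to 0: the asymptotics exclude the exponentially growing solution.\<close>
  then have "((\<lambda>x. complex_of_real (exp (- x) / x) *
      (of_real x * (f (of_real x) + c * exp_stieltjes (of_real x)))) \<longlongrightarrow> 0 * (1 + c * 1)) at_top"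
    using lim1 by (intro tendsto_mult) simp_all
  moreover have ev: "\<forall>\<^sub>F x in at_top. complex_of_real x \<in> ?S"
    using eventually_gt_at_top[of "0::real"] by eventually_elim auto
  then have "\<forall>\<^sub>F x in at_top. complex_of_real (exp (- x) / x) *
      (of_real x * (f (of_real x) + c * exp_stieltjes (of_real x))) = d"
    using eventually_gt_at_top[of "0::real"]
  proof eventually_elim
    case (elim x)
    show ?case
      using d[OF elim(1)] elim(2) by (simp add: exp_of_real flip: of_real_minus)
  qed
  ultimately have "((\<lambda>x::real. d) \<longlongrightarrow> 0) at_top"
    by (simp add: tendsto_cong)
  then have d0: "d = 0" by (simp add: tendsto_const_iff)
  have eq: "f w + c * exp_stieltjes w = 0" if "w \<in> ?S" for w
    using d[OF that] d0 by simp
  \<comment> \<open>With \<open>d = 0\<close> the combination vanishes identically, so its limit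
    \<open>1 + c\<close> must be 0.\<close>
  have "\<forall>\<^sub>F x in at_top. of_real x * (f (of_real x) + c * exp_stieltjes (of_real x)) = 0"
    using ev by eventually_elim (simp add: eq)
  from tendsto_unique[OF trivial_limit_at_top_linorder lim1 tendsto_eventually[OF this]]
  have "c = - 1"
    by (simp add: add_eq_0_iff)
  then show ?thesis using eq[OF z] by simp
qed

text \<open>The definite description ranges over values at \<open>z\<close>, so agreement of all
  solutions off the cut is enough to make it well defined.\<close>

lemma tricomi_U_1_1:
  assumes "z \<in> - \<real>\<^sub>\<le>\<^sub>0"
  shows "tricomi_U 1 1 z = exp_stieltjes z"
  unfolding tricomi_U_def
  using is_tricomi_U_1_1_unique[OF _ assms] is_tricomi_U_exp_stieltjes
  by (intro the_equality) blast+

section \<open>Macdonald's function of order one half\<close>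

lemma bessel_I_series_summable:
  fixes \<alpha> x :: complex
  shows "summable (\<lambda>k. x ^ k * rGamma (\<alpha> + of_nat k + 1) / fact k)"
proof -
  \<comment> \<open>From this index on, \<open>norm (\<alpha> + k + 1) \<ge> 1\<close>, so the
    reciprocal Gamma factors do not grow, and \<open>norm x / (k + 1) \<le> 1 / 2\<close>.\<close>
  define N where "N = nat \<lceil>2 * norm x + norm \<alpha> + 1\<rceil>"
  show ?thesis
  proof (rule summable_ratio_test[where c = "1 / 2" and N = N])
    fix k assume "k \<ge> N"
    then have k: "real k \<ge> 2 * norm x + norm \<alpha> + 1" unfolding N_def by linarith
    have "real (k + 1) = norm ((\<alpha> + of_nat k + 1) - \<alpha>)"
      by (metis add.assoc add_diff_cancel_left' norm_of_nat of_nat_1 of_nat_add)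
    also have "\<dots> \<le> norm (\<alpha> + of_nat k + 1) + norm \<alpha>"
      by (rule norm_triangle_ineq4)
    finally have "real (k + 1) \<le> norm (\<alpha> + of_nat k + 1) + norm \<alpha>" .
    moreover have "0 \<le> 2 * norm x" by simp
    ultimately have ge: "norm (\<alpha> + of_nat k + 1) \<ge> 1" using k by linarith
    have "rGamma (\<alpha> + of_nat k + 1) = (\<alpha> + of_nat k + 1) * rGamma (\<alpha> + of_nat (Suc k) + 1)"
      using rGamma_plus1[of "\<alpha> + of_nat k + 1"] by (simp add: add_ac)
    then have "norm (rGamma (\<alpha> + of_nat k + 1)) =
        norm (\<alpha> + of_nat k + 1) * norm (rGamma (\<alpha> + of_nat (Suc k) + 1))"
      by (simp only: norm_mult)
    then have le: "norm (rGamma (\<alpha> + of_nat (Suc k) + 1)) \<le> norm (rGamma (\<alpha> + of_nat k + 1))"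
      using mult_right_mono[OF ge, of "norm (rGamma (\<alpha> + of_nat (Suc k) + 1))"] by simp
    have "norm x / real (Suc k) \<le> 1 / 2"
      using k norm_ge_zero[of \<alpha>] by (simp add: field_simps del: norm_ge_zero)
    then have "norm x / real (Suc k) * (norm (x ^ k) * norm (rGamma (\<alpha> + of_nat (Suc k) + 1)) / fact k)
        \<le> 1 / 2 * (norm (x ^ k) * norm (rGamma (\<alpha> + of_nat k + 1)) / fact k)"
      using le by (intro mult_mono divide_right_mono mult_left_mono) auto
    then show "norm (x ^ Suc k * rGamma (\<alpha> + of_nat (Suc k) + 1) / fact (Suc k)) \<le>
        1 / 2 * norm (x ^ k * rGamma (\<alpha> + of_nat k + 1) / fact k)"
      by (simp add: norm_mult norm_divide norm_power mult_ac flip: of_nat_Suc)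
  qed simp
qed

lemma bessel_I_recurrence:
  assumes z: "z \<noteq> 0"
  shows "bessel_I (\<alpha> - 1) z - bessel_I (\<alpha> + 1) z = 2 * \<alpha> / z * bessel_I \<alpha> z"
proof -
  define x where "x = z\<^sup>2 / 4"
  define J where "J \<beta> = (\<Sum>k. x ^ k * rGamma (\<beta> + of_nat k + 1) / fact k)" for \<beta> :: complex
  \<comment> \<open>The functional equation of \<open>rGamma\<close> splits the coefficient of order
    \<open>\<alpha> - 1\<close> as \<open>(\<alpha> + k)\<close> times that of order
    \<open>\<alpha>\<close>. \<open>D\<close> is the part with the factor \<open>k\<close>;
    cancelling \<open>k\<close> against the factorial and shifting the index makes it the series of
    order \<open>\<alpha> + 1\<close>.\<close>
  define D where "D k = x ^ k * rGamma (\<alpha> + of_nat k + 1) * of_nat k / fact k" for k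
  have sm: "summable (\<lambda>k. x ^ k * rGamma (\<beta> + of_nat k + 1) / fact k)" for \<beta> :: complex
    by (rule bessel_I_series_summable)
  have DSuc: "D (Suc k) = x * (x ^ k * rGamma (\<alpha> + 1 + of_nat k + 1) / fact k)" for k
  proof -
    have "1 + of_nat k \<noteq> (0::complex)" by (metis of_nat_Suc of_nat_neq_0)
    then show ?thesis
      unfolding D_def by (simp add: add_ac)
  qed
  have "(\<lambda>k. D (Suc k)) sums (x * J (\<alpha> + 1))"
    unfolding DSuc J_def by (intro sums_mult summable_sums sm)
  then have D: "D sums (x * J (\<alpha> + 1))"
    by (subst (asm) sums_Suc_iff) (simp add: D_def)
  have "x ^ k * rGamma (\<alpha> - 1 + of_nat k + 1) / fact k - D k =
      \<alpha> * (x ^ k * rGamma (\<alpha> + of_nat k + 1) / fact k)" for k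
  proof -
    have "rGamma (\<alpha> - 1 + of_nat k + 1) = (\<alpha> + of_nat k) * rGamma (\<alpha> + of_nat k + 1)"
      using rGamma_plus1[of "\<alpha> + of_nat k"] by simp
    then show ?thesis
      unfolding D_def by (simp add: field_simps)
  qed
  moreover have "(\<lambda>k. x ^ k * rGamma (\<alpha> - 1 + of_nat k + 1) / fact k - D k) sums
      (J (\<alpha> - 1) - x * J (\<alpha> + 1))"
    unfolding J_def[of "\<alpha> - 1"] by (intro sums_diff D summable_sums sm)
  moreover have "(\<lambda>k. \<alpha> * (x ^ k * rGamma (\<alpha> + of_nat k + 1) / fact k)) sums (\<alpha> * J \<alpha>)"
    unfolding J_def by (intro sums_mult summable_sums sm)
  ultimately have J: "J (\<alpha> - 1) - x * J (\<alpha> + 1) = \<alpha> * J \<alpha>"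
    by (simp add: sums_unique2)
  have p: "(z / 2) powr (\<alpha> - 1) = (z / 2) powr \<alpha> * (2 / z)"
    "(z / 2) powr (\<alpha> + 1) = (z / 2) powr \<alpha> * (z / 2)"
    using z by (simp_all add: powr_diff powr_add)
  have "bessel_I (\<alpha> - 1) z - bessel_I (\<alpha> + 1) z =
      (z / 2) powr \<alpha> * (2 / z) * (J (\<alpha> - 1) - x * J (\<alpha> + 1))"
    unfolding bessel_I_def x_def[symmetric] J_def[symmetric] p
    using z by (simp add: x_def field_simps power2_eq_square)
  also have "\<dots> = 2 * \<alpha> / z * bessel_I \<alpha> z"
    unfolding J bessel_I_def x_def[symmetric] J_def[symmetric] by simp
  finally show ?thesis .
qed

text \<open>Off the integers all three orders are given by Macdonald's quotient, and the sine
  changes sign under unit shifts. The recurrence of \<open>bessel_I\<close> at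
  \<open>\<alpha>\<close> and at \<open>- \<alpha>\<close> therefore carries over, with the sign of
  the middle term reversed.\<close>

lemma bessel_K_recurrence:
  assumes z: "z \<noteq> 0" and \<alpha>: "\<alpha> \<notin> \<int>"
  shows "bessel_K (\<alpha> + 1) z = bessel_K (\<alpha> - 1) z + 2 * \<alpha> / z * bessel_K \<alpha> z"
proof -
  have \<alpha>': "\<alpha> + 1 \<notin> \<int>" "\<alpha> - 1 \<notin> \<int>"
    using \<alpha> Ints_diff[of "\<alpha> + 1" 1] Ints_add[of "\<alpha> - 1" 1] by auto
  define S where "S = sin (of_real pi * \<alpha>)"
  have s: "sin (of_real pi * (\<alpha> + 1)) = - S" "sin (of_real pi * (\<alpha> - 1)) = - S"
    by (simp_all add: S_def distrib_left right_diff_distrib sin_add sin_diff cos_of_real sin_of_real)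
  have K: "bessel_K (\<alpha> + 1) z = of_real pi / 2 * (bessel_I (- \<alpha> - 1) z - bessel_I (\<alpha> + 1) z) / (- S)"
    "bessel_K (\<alpha> - 1) z = of_real pi / 2 * (bessel_I (1 - \<alpha>) z - bessel_I (\<alpha> - 1) z) / (- S)"
    "bessel_K \<alpha> z = of_real pi / 2 * (bessel_I (- \<alpha>) z - bessel_I \<alpha> z) / S"
    using \<alpha> \<alpha>' by (simp_all add: bessel_K_def Let_def s S_def[symmetric])
  have I1: "bessel_I (\<alpha> - 1) z = bessel_I (\<alpha> + 1) z + 2 * \<alpha> / z * bessel_I \<alpha> z"
    using bessel_I_recurrence[OF z, of \<alpha>] by (simp add: algebra_simps)
  have I2: "bessel_I (- \<alpha> - 1) z = bessel_I (1 - \<alpha>) z - 2 * \<alpha> / z * bessel_I (- \<alpha>) z"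
    using bessel_I_recurrence[OF z, of "- \<alpha>"] by (simp add: algebra_simps)
  show ?thesis
    unfolding K I1 I2 by (simp add: algebra_simps add_divide_distrib diff_divide_distrib)
qed

lemma bessel_K_uminus:
  assumes "\<alpha> \<notin> \<int>"
  shows "bessel_K (- \<alpha>) z = bessel_K \<alpha> z"
proof -
  have "- \<alpha> \<notin> \<int>" using assms Ints_minus by fastforce
  then show ?thesis
    using assms by (simp add: bessel_K_def Let_def algebra_simps diff_divide_distrib)
qed

section \<open>Closed forms at order one half\<close>

lemma of_nat_half_notin_Ints: "of_nat n + 1 / 2 \<notin> (\<int> :: complex set)"
proof
  assume "of_nat n + 1 / 2 \<in> (\<int> :: complex set)"
  then obtain i where "of_nat n + 1 / 2 = (of_int i :: complex)" by (auto elim: Ints_cases)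
  then have "of_int (2 * int n + 1) = (of_int (2 * i) :: complex)" by (simp add: field_simps)
  then show False by (subst (asm) of_int_eq_iff) presburger
qed

lemma of_nat_half_neq_0: "of_nat k + 1 / 2 \<noteq> (0::complex)"
  using of_nat_half_notin_Ints[of k] Ints_0 by metis

text \<open>A form of the duplication formula: it turns the Gamma factors into
  \<open>fact (2 * k)\<close>, so that the Bessel series of order \<open>1 / 2\<close> and
  \<open>- 1 / 2\<close> become those of \<open>sinh\<close> and \<open>cosh\<close>.\<close>

lemma rGamma_half_of_nat:
  "rGamma (of_nat k + 1 / 2 :: complex) / fact k = 4 ^ k / (of_real (sqrt pi) * fact (2 * k))"
proof (induction k)
  case 0
  then show ?case by (simp add: rGamma_inverse_Gamma Gamma_one_half_complex field_simps)
next
  case (Suc k)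
  note nz = of_nat_half_neq_0[of k]
  have "(of_nat k + 1 / 2) * rGamma (of_nat (Suc k) + 1 / 2) = rGamma (of_nat k + 1 / 2 :: complex)"
    using rGamma_plus1[of "of_nat k + 1 / 2 :: complex"] by (simp add: add_ac)
  then have "rGamma (of_nat (Suc k) + 1 / 2 :: complex) = rGamma (of_nat k + 1 / 2) / (of_nat k + 1 / 2)"
    using nz by (simp add: field_simps)
  then have "rGamma (of_nat (Suc k) + 1 / 2 :: complex) / fact (Suc k) =
      rGamma (of_nat k + 1 / 2) / fact k / ((of_nat k + 1 / 2) * of_nat (Suc k))"
    by (simp add: mult_ac)
  also have "\<dots> = 4 ^ k / (of_real (sqrt pi) * fact (2 * k)) / ((of_nat k + 1 / 2) * of_nat (Suc k))"
    by (simp only: Suc.IH)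
  also have "(of_nat k + 1 / 2) * of_nat (Suc k) = (of_nat (Suc (2 * k)) * of_nat (Suc (Suc (2 * k))) / 4 :: complex)"
    by (simp add: field_simps)
  finally show ?case
    by (simp add: mult_ac)
qed

lemma bessel_I_minus_half:
  "bessel_I (- (1 / 2)) z = (z / 2) powr (- (1 / 2)) * cosh z / of_real (sqrt pi)"
proof -
  have "(\<lambda>k. if even k then z ^ k /\<^sub>R fact k else 0) sums cosh z"
    by (rule cosh_converges)
  moreover have "(if even n then z ^ n /\<^sub>R fact n else 0) = 0" if "n \<notin> range (\<lambda>k. 2 * k)" for n
    using that by (auto elim!: evenE)
  ultimately have "(\<lambda>k. z ^ (2 * k) /\<^sub>R fact (2 * k)) sums cosh z"
    using sums_mono_reindex[of "\<lambda>k. 2 * k" "\<lambda>k. if even k then z ^ k /\<^sub>R fact k else 0" "cosh z"]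
    by (simp add: strict_mono_def)
  then have "(\<lambda>k. z ^ (2 * k) /\<^sub>R fact (2 * k) / of_real (sqrt pi)) sums (cosh z / of_real (sqrt pi))"
    by (rule sums_divide)
  moreover have "z ^ (2 * k) /\<^sub>R fact (2 * k) / of_real (sqrt pi) =
      (z\<^sup>2 / 4) ^ k * rGamma (- (1 / 2) + of_nat k + 1) / fact k" for k
  proof -
    have "(z\<^sup>2 / 4) ^ k * rGamma (- (1 / 2) + of_nat k + 1) / fact k =
        (z\<^sup>2 / 4) ^ k * (rGamma (of_nat k + 1 / 2) / fact k)"
      by (simp add: add.commute)
    then show ?thesis
      unfolding rGamma_half_of_nat
      by (simp add: power_mult power_divide scaleR_conv_of_real) (simp add: field_simps)
  qed
  ultimately show ?thesis
    unfolding bessel_I_def by (simp add: sums_iff)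
qed

text \<open>The prefactor carries the exponent \<open>- (1 / 2)\<close> to match the formula for
  order \<open>- (1 / 2)\<close>; the difference of the two is then a multiple of
  \<open>cosh z - sinh z = exp (- z)\<close>.\<close>

lemma bessel_I_half:
  assumes z: "z \<noteq> 0"
  shows "bessel_I (1 / 2) z = (z / 2) powr (- (1 / 2)) * sinh z / of_real (sqrt pi)"
proof -
  have "(\<lambda>k. if even k then 0 else z ^ k /\<^sub>R fact k) sums sinh z"
    by (rule sinh_converges)
  moreover have "(if even n then 0 else z ^ n /\<^sub>R fact n) = 0" if "n \<notin> range (\<lambda>k. 2 * k + 1)" for n
    using that by (auto elim!: oddE)
  ultimately have "(\<lambda>k. z ^ (2 * k + 1) /\<^sub>R fact (2 * k + 1)) sums sinh z"
    using sums_mono_reindex[of "\<lambda>k. 2 * k + 1" "\<lambda>k. if even k then 0 else z ^ k /\<^sub>R fact k" "sinh z"]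
    by (simp add: strict_mono_def del: fact_Suc power_Suc)
  then have "(\<lambda>k. z ^ (2 * k + 1) /\<^sub>R fact (2 * k + 1) * (2 / (z * of_real (sqrt pi)))) sums
      (sinh z * (2 / (z * of_real (sqrt pi))))"
    by (rule sums_mult2)
  moreover have "z ^ (2 * k + 1) /\<^sub>R fact (2 * k + 1) * (2 / (z * of_real (sqrt pi))) =
      (z\<^sup>2 / 4) ^ k * rGamma (1 / 2 + of_nat k + 1) / fact k" for k
  proof -
    have nz: "(2 * of_nat k + 1 :: complex) \<noteq> 0"
      using of_nat_half_neq_0[of k] by (simp add: field_simps)
    have "(of_nat k + 1 / 2) * rGamma (1 / 2 + of_nat k + 1) = rGamma (of_nat k + 1 / 2 :: complex)"
      using rGamma_plus1[of "of_nat k + 1 / 2 :: complex"] by (simp add: add_ac)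
    then have "rGamma (1 / 2 + of_nat k + 1 :: complex) = 2 * rGamma (of_nat k + 1 / 2) / (2 * of_nat k + 1)"
      using nz by (simp add: field_simps)
    then have "(z\<^sup>2 / 4) ^ k * rGamma (1 / 2 + of_nat k + 1) / fact k =
        (z\<^sup>2 / 4) ^ k * 2 / (2 * of_nat k + 1) * (rGamma (of_nat k + 1 / 2) / fact k)"
      by simp
    then show ?thesis
      using z nz unfolding rGamma_half_of_nat
      by (simp add: power_mult power_divide scaleR_conv_of_real) (simp add: field_simps)
  qed
  ultimately have "(\<Sum>k. (z\<^sup>2 / 4) ^ k * rGamma (1 / 2 + of_nat k + 1) / fact k) =
      sinh z * (2 / (z * of_real (sqrt pi)))"
    by (simp add: sums_iff)
  moreover have "(z / 2) powr (1 / 2) = (z / 2) powr (- (1 / 2)) * (z / 2)"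
    using z powr_add[of "z / 2" "- (1 / 2)" 1] by simp
  ultimately show ?thesis
    unfolding bessel_I_def using z by (simp only: field_simps) simp
qed

lemma bessel_K_half:
  assumes "z \<noteq> 0"
  shows "bessel_K (1 / 2) z = of_real (sqrt pi) / 2 * (z / 2) powr (- (1 / 2)) * exp (- z)"
proof -
  have h: "1 / 2 \<notin> (\<int> :: complex set)" using of_nat_half_notin_Ints[of 0] by simp
  have s: "sin (of_real pi * (1 / 2)) = (1::complex)"
    using sin_of_real[of "pi / 2", where ?'a = complex] by simp
  have "of_real pi = (of_real (sqrt pi) * of_real (sqrt pi) :: complex)"
    by (simp flip: of_real_mult)
  then show ?thesis
    using h unfolding bessel_K_def Let_def if_not_P[OF h] s bessel_I_minus_half bessel_I_half[OF assms]
    by (simp add: cosh_def sinh_def scaleR_conv_of_real field_simps)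
qed

section \<open>Iterated radial derivatives\<close>

text \<open>\<open>radial_deriv j s a b\<close> is the \<open>j\<close>-fold application of \<open>- (1 / m) \<partial>/\<partial>m\<close>, at constant \<open>t\<close>, to
  \<open>exp (- s m) / (m ^ a (m + t) ^ b)\<close>.\<close>

primrec radial_deriv :: "nat \<Rightarrow> complex \<Rightarrow> nat \<Rightarrow> nat \<Rightarrow> real \<Rightarrow> real \<Rightarrow> complex" where
  "radial_deriv 0 s a b m t = exp (- s * of_real m) * of_real (inverse m ^ a * inverse (m + t) ^ b)"
| "radial_deriv (Suc j) s a b m t = s * radial_deriv j s (a + 1) b m t
    + of_nat a * radial_deriv j s (a + 2) b m t + of_nat b * radial_deriv j s (a + 1) (b + 1) m t"

text \<open>Partial fractions, \<open>t / (m * (m + t)) = 1 / m - 1 / (m + t)\<close>, settle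
  \<open>j = 0\<close>. Multiplication by \<open>t\<close> commutes with the radial operator, so the
  identity survives iteration.\<close>

lemma radial_deriv_mult_snd:
  assumes "m \<noteq> 0" "m + t \<noteq> 0"
  shows "of_real t * radial_deriv j s (a + 1) (b + 1) m t =
    radial_deriv j s (a + 1) b m t - radial_deriv j s a (b + 1) m t"
proof (induction j arbitrary: a b)
  case 0
  have "t * (inverse m ^ (a + 1) * inverse (m + t) ^ (b + 1)) =
      inverse m ^ (a + 1) * inverse (m + t) ^ b - inverse m ^ a * inverse (m + t) ^ (b + 1)"
  proof -
    have "inverse m ^ a * inverse (m + t) ^ b * (t * (inverse m * inverse (m + t))) =
        inverse m ^ a * inverse (m + t) ^ b * (inverse m - inverse (m + t))"
      using assms by (simp add: field_simps)
    then show ?thesis by (simp add: algebra_simps)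
  qed
  then have "complex_of_real t * of_real (inverse m ^ (a + 1) * inverse (m + t) ^ (b + 1)) =
      of_real (inverse m ^ (a + 1) * inverse (m + t) ^ b) - of_real (inverse m ^ a * inverse (m + t) ^ (b + 1))"
    by (simp only: flip: of_real_mult of_real_diff)
  then have "exp (- s * of_real m) * (complex_of_real t * of_real (inverse m ^ (a + 1) * inverse (m + t) ^ (b + 1))) =
      exp (- s * of_real m) * (of_real (inverse m ^ (a + 1) * inverse (m + t) ^ b)
       - of_real (inverse m ^ a * inverse (m + t) ^ (b + 1)))"
    by simp
  then show ?case by (simp only: radial_deriv.simps right_diff_distrib mult_ac)
next
  case (Suc j)
  have "of_real t * radial_deriv (Suc j) s (a + 1) (b + 1) m t =
    s * (of_real t * radial_deriv j s (a + 1 + 1) (b + 1) m t)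
    + of_nat (a + 1) * (of_real t * radial_deriv j s (a + 2 + 1) (b + 1) m t)
    + of_nat (b + 1) * (of_real t * radial_deriv j s (a + 1 + 1) (b + 1 + 1) m t)"
    by (simp add: algebra_simps)
  also have "\<dots> = radial_deriv (Suc j) s (a + 1) b m t - radial_deriv (Suc j) s a (b + 1) m t"
    unfolding Suc.IH by (simp add: algebra_simps)
  finally show ?case .
qed

text \<open>Both sides arise from \<open>j = 0\<close> by the radial operator, which commutes with \<open>s - d/dt\<close>.\<close>

lemma radial_deriv_raise:
  assumes "m \<noteq> 0" "m + t \<noteq> 0"
  shows "s * radial_deriv j s 1 (b + 1) m t + of_real t * radial_deriv (Suc j) s 1 (b + 1) m t
    + of_nat (b + 1) * radial_deriv j s 1 (b + 2) m t = radial_deriv (Suc j) s 1 b m t"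
proof -
  note e = radial_deriv_mult_snd[OF assms, of j s]
  have "of_real t * radial_deriv (Suc j) s 1 (b + 1) m t =
    s * (of_real t * radial_deriv j s (1 + 1) (b + 1) m t)
    + of_real t * radial_deriv j s (2 + 1) (b + 1) m t
    + of_nat (b + 1) * (of_real t * radial_deriv j s (1 + 1) (b + 1 + 1) m t)"
    by (simp add: algebra_simps)
  also have "\<dots> = s * (radial_deriv j s 2 b m t - radial_deriv j s 1 (b + 1) m t)
    + (radial_deriv j s 3 b m t - radial_deriv j s 2 (b + 1) m t)
    + of_nat (b + 1) * (radial_deriv j s 2 (b + 1) m t - radial_deriv j s 1 (b + 2) m t)"
    unfolding e by (simp add: numeral_eq_Suc)
  finally show ?thesis
    by (simp add: algebra_simps numeral_eq_Suc)
qed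

text \<open>The radial operator sends \<open>m^2\<close> to the constant \<open>- 2\<close>, so in
  the Leibniz rule for the \<open>j\<close>-fold application to a product with \<open>m^2\<close>
  only one correction term, with factor \<open>2 * j\<close>, remains.\<close>

lemma radial_deriv_mult_square:
  assumes "m \<noteq> 0"
  shows "(of_real m)\<^sup>2 * radial_deriv j s (a + 2) b m t =
    radial_deriv j s a b m t + 2 * of_nat j * radial_deriv (j - 1) s (a + 2) b m t"
proof (induction j arbitrary: a b)
  case 0
  have "m\<^sup>2 * (inverse m ^ (a + 2) * inverse (m + t) ^ b) = inverse m ^ a * inverse (m + t) ^ b"
    using assms by (simp add: power2_eq_square field_simps)
  then have "(of_real m)\<^sup>2 * complex_of_real (inverse m ^ (a + 2) * inverse (m + t) ^ b)
      = of_real (inverse m ^ a * inverse (m + t) ^ b)"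
    by (simp only: flip: of_real_mult of_real_power)
  then show ?case by (simp only: radial_deriv.simps) (simp add: mult_ac)
next
  case (Suc j)
  have "(of_real m)\<^sup>2 * radial_deriv (Suc j) s (a + 2) b m t =
    s * ((of_real m)\<^sup>2 * radial_deriv j s (a + 1 + 2) b m t)
    + of_nat (a + 2) * ((of_real m)\<^sup>2 * radial_deriv j s (a + 2 + 2) b m t)
    + of_nat b * ((of_real m)\<^sup>2 * radial_deriv j s (a + 1 + 2) (b + 1) m t)"
    by (simp add: algebra_simps)
  also have "\<dots> = radial_deriv (Suc j) s a b m t + 2 * radial_deriv j s (a + 2) b m t
     + 2 * of_nat j * (s * radial_deriv (j - 1) s (a + 3) b m t
       + of_nat (a + 2) * radial_deriv (j - 1) s (a + 4) b m t
       + of_nat b * radial_deriv (j - 1) s (a + 3) (b + 1) m t)"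
    unfolding Suc.IH by (simp add: algebra_simps numeral_eq_Suc)
  also have "2 * of_nat j * (s * radial_deriv (j - 1) s (a + 3) b m t
       + of_nat (a + 2) * radial_deriv (j - 1) s (a + 4) b m t
       + of_nat b * radial_deriv (j - 1) s (a + 3) (b + 1) m t)
     = 2 * of_nat j * radial_deriv j s (a + 2) b m t"
    \<comment> \<open>At \<open>j = 0\<close> the factor \<open>j\<close> annihilates both sides, so
      the truncated \<open>j - 1\<close> is harmless.\<close>
    by (cases j) (simp_all add: numeral_eq_Suc)
  finally show ?case by (simp add: algebra_simps)
qed

text \<open>This is the three-term recurrence of \<open>bessel_K\<close> between the orders
  \<open>n + 1/2\<close>, \<open>n + 3/2\<close> and \<open>n + 5/2\<close>, freed of its powers of
  \<open>s * m\<close>. One application of the radial operator is unfolded and \<open>m^2\<close> is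
  moved past the others.\<close>

lemma radial_deriv_recurrence:
  assumes "m \<noteq> 0"
  shows "(of_real m)\<^sup>2 * radial_deriv (Suc (Suc n)) s 1 0 m t =
    s\<^sup>2 * radial_deriv n s 1 0 m t + (2 * of_nat n + 3) * radial_deriv (Suc n) s 1 0 m t"
proof -
  have "(of_real m)\<^sup>2 * radial_deriv (Suc (Suc n)) s 1 0 m t =
    s * ((of_real m)\<^sup>2 * radial_deriv (Suc n) s (0 + 2) 0 m t)
    + (of_real m)\<^sup>2 * radial_deriv (Suc n) s (1 + 2) 0 m t"
    unfolding radial_deriv.simps(2)[of "Suc n" s 1] by (simp add: algebra_simps numeral_eq_Suc)
  also have "\<dots> = s * (radial_deriv (Suc n) s 0 0 m t + 2 * of_nat (Suc n) * radial_deriv n s 2 0 m t)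
    + (radial_deriv (Suc n) s 1 0 m t + 2 * of_nat (Suc n) * radial_deriv n s 3 0 m t)"
    unfolding radial_deriv_mult_square[OF assms] by (simp add: numeral_eq_Suc)
  also have "radial_deriv (Suc n) s 0 0 m t = s * radial_deriv n s 1 0 m t"
    by simp
  also have "s * (s * radial_deriv n s 1 0 m t + 2 * of_nat (Suc n) * radial_deriv n s 2 0 m t)
    + (radial_deriv (Suc n) s 1 0 m t + 2 * of_nat (Suc n) * radial_deriv n s 3 0 m t) =
    s\<^sup>2 * radial_deriv n s 1 0 m t + radial_deriv (Suc n) s 1 0 m t
    + 2 * of_nat (Suc n) * (s * radial_deriv n s 2 0 m t + radial_deriv n s 3 0 m t)"
    by (simp only: power2_eq_square algebra_simps)
  also have "s * radial_deriv n s 2 0 m t + radial_deriv n s 3 0 m t = radial_deriv (Suc n) s 1 0 m t"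
    by (simp add: numeral_eq_Suc)
  finally show ?thesis by (simp add: algebra_simps)
qed

text \<open>Iterated radial derivatives of \<open>exp (- s * m) / m\<close> give the Macdonald
  functions of half-integer order: both sides obey the same recurrence and agree for
  \<open>n = 0\<close> and \<open>n = 1\<close>. With \<open>b = 0\<close> the value is the same for
  every \<open>t\<close>, which is later taken along the curve of integration.\<close>

lemma bessel_K_half_integer:
  assumes s: "s \<noteq> 0" and m: "m > 0"
  shows "bessel_K (of_nat n + 1 / 2) (s * of_real m) =
    of_real (sqrt pi) / 2 * (s * of_real m / 2) powr (- (1 / 2))
      * (s * of_real m) ^ (n + 1) / s ^ (2 * n + 1) * radial_deriv n s 1 0 m t"
proof -
  define w where "w = s * of_real m"
  define P where "P = of_real (sqrt pi) / 2 * (w / 2) powr (- (1 / 2))"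
  define K where "K n = bessel_K (of_nat n + 1 / 2) w" for n
  have w: "w \<noteq> 0" using s m by (simp add: w_def)
  have m0: "of_real m \<noteq> (0::complex)" using m by simp
  have K0: "K 0 = P * exp (- w)"
    using bessel_K_half[OF w] by (simp add: K_def P_def)
  \<comment> \<open>The recurrence at order \<open>1 / 2\<close> reaches down to
    \<open>- (1 / 2)\<close>, which evenness in the order identifies with
    \<open>1 / 2\<close>.\<close>
  have K1: "K (Suc 0) = K 0 + K 0 / w"
  proof -
    have "1 / 2 \<notin> (\<int> :: complex set)" using of_nat_half_notin_Ints[of 0] by simp
    from bessel_K_recurrence[OF w this] bessel_K_uminus[OF this, of w]
    show ?thesis by (simp add: K_def add.commute)
  qed
  have K2: "K (Suc (Suc n)) = K n + (2 * of_nat n + 3) / w * K (Suc n)" for n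
    using bessel_K_recurrence[OF w of_nat_half_notin_Ints[of "Suc n"]]
    by (simp add: K_def algebra_simps add_divide_distrib)
  have "K n = P * w ^ (n + 1) / s ^ (2 * n + 1) * radial_deriv n s 1 0 m t"
  proof (induction n rule: induct_nat_012)
    case 0
    show ?case using s m0 by (simp add: K0 w_def)
  next
    case 1
    show ?case using s m0 unfolding K1 K0
      by (simp add: w_def field_simps power2_eq_square numeral_eq_Suc)
  next
    case (ge2 n)
    have r: "radial_deriv (Suc (Suc n)) s 1 0 m t =
      (s\<^sup>2 * radial_deriv n s 1 0 m t + (2 * of_nat n + 3) * radial_deriv (Suc n) s 1 0 m t) / (of_real m)\<^sup>2"
      using radial_deriv_recurrence[of m n s t] m0 m by (simp add: field_simps)
    show ?case
      unfolding K2 ge2 r using s m0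
      by (simp add: w_def field_simps power2_eq_square del: radial_deriv.simps)
  qed
  then show ?thesis by (simp add: K_def P_def w_def)
qed

section \<open>Differentiation and decay of the iterated radial derivatives\<close>

lemma has_real_derivative_inverse_power:
  assumes "(f has_real_derivative f') (at x)" "f x \<noteq> 0"
  shows "((\<lambda>x. inverse (f x) ^ a) has_real_derivative - (real a * f' * inverse (f x) ^ (a + 1))) (at x)"
proof (cases a)
  case (Suc n)
  show ?thesis
    unfolding Suc using DERIV_power_Suc[OF DERIV_inverse_fun[OF assms], of n]
    by (rule DERIV_cong) (simp add: algebra_simps)
qed simp

text \<open>Chain rule along a curve: by its definition the radial operator makes the partial
  derivative in \<open>m\<close> equal to \<open>- m\<close> times the next iterate, while the
  partial derivative in \<open>t\<close> commutes with it and only raises \<open>b\<close>.\<close>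

lemma has_vector_derivative_radial_deriv:
  assumes m: "(m has_real_derivative m') (at x)" and t: "(t has_real_derivative t') (at x)"
    and nz: "m x \<noteq> 0" "m x + t x \<noteq> 0"
  shows "((\<lambda>x. radial_deriv j s a b (m x) (t x)) has_vector_derivative
    - of_real (m x * m') * radial_deriv (Suc j) s a b (m x) (t x)
    - of_real t' * of_nat b * radial_deriv j s a (b + 1) (m x) (t x)) (at x)"
proof (induction j arbitrary: a b)
  case 0
  define g where "g = (\<lambda>x. inverse (m x) ^ a * inverse (m x + t x) ^ b)"
  have g: "(g has_real_derivative
      - (real a * m' * inverse (m x) ^ (a + 1)) * inverse (m x + t x) ^ b
      - inverse (m x) ^ a * (real b * (m' + t') * inverse (m x + t x) ^ (b + 1))) (at x)"
    unfolding g_def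
    by (rule DERIV_cong[OF DERIV_mult[OF has_real_derivative_inverse_power[OF m nz(1)]
          has_real_derivative_inverse_power[OF DERIV_add[OF m t] nz(2)]]]) simp
  have "((\<lambda>x. exp (- s * of_real (m x)) * of_real (g x)) has_vector_derivative
    exp (- s * of_real (m x)) * of_real (- (real a * m' * inverse (m x) ^ (a + 1)) * inverse (m x + t x) ^ b
      - inverse (m x) ^ a * (real b * (m' + t') * inverse (m x + t x) ^ (b + 1)))
    + (of_real m' * (- s) * exp (- s * of_real (m x))) * of_real (g x)) (at x)"
  proof (rule has_vector_derivative_mult)
    have "((\<lambda>w. exp (- s * w)) has_field_derivative (- s) * exp (- s * of_real (m x))) (at (of_real (m x)))"
      by (auto intro!: derivative_eq_intros)
    then have "((\<lambda>w. exp (- s * w)) \<circ> (\<lambda>x. of_real (m x)) has_vector_derivative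
        of_real m' * ((- s) * exp (- s * of_real (m x)))) (at x)"
      using m by (intro field_vector_diff_chain_at has_vector_derivative_of_real)
        (auto simp: has_real_derivative_iff_has_vector_derivative)
    then show "((\<lambda>x. exp (- s * of_real (m x))) has_vector_derivative
        of_real m' * (- s) * exp (- s * of_real (m x))) (at x)"
      by (simp add: o_def mult_ac)
    show "((\<lambda>x. complex_of_real (g x)) has_vector_derivative
      of_real (- (real a * m' * inverse (m x) ^ (a + 1)) * inverse (m x + t x) ^ b
      - inverse (m x) ^ a * (real b * (m' + t') * inverse (m x + t x) ^ (b + 1)))) (at x)"
      using g by (intro has_vector_derivative_of_real)
        (simp add: has_real_derivative_iff_has_vector_derivative)
  qed
  moreover have "complex_of_real (m x) \<noteq> 0" "complex_of_real (m x) + of_real (t x) \<noteq> 0"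
    using nz by (auto simp flip: of_real_add)
  then have "exp (- s * of_real (m x)) * of_real (- (real a * m' * inverse (m x) ^ (a + 1)) * inverse (m x + t x) ^ b
      - inverse (m x) ^ a * (real b * (m' + t') * inverse (m x + t x) ^ (b + 1)))
    + (of_real m' * (- s) * exp (- s * of_real (m x))) * of_real (g x) =
    - of_real (m x * m') * radial_deriv (Suc 0) s a b (m x) (t x)
    - of_real t' * of_nat b * radial_deriv 0 s a (b + 1) (m x) (t x)"
    using nz by (simp add: g_def numeral_eq_Suc divide_simps) (simp add: algebra_simps)
  ultimately show ?case unfolding g_def by simp
next
  case (Suc j)
  have "((\<lambda>x. s * radial_deriv j s (a + 1) b (m x) (t x)
    + of_nat a * radial_deriv j s (a + 2) b (m x) (t x)
    + of_nat b * radial_deriv j s (a + 1) (b + 1) (m x) (t x)) has_vector_derivative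
    s * (- of_real (m x * m') * radial_deriv (Suc j) s (a + 1) b (m x) (t x)
      - of_real t' * of_nat b * radial_deriv j s (a + 1) (b + 1) (m x) (t x))
    + of_nat a * (- of_real (m x * m') * radial_deriv (Suc j) s (a + 2) b (m x) (t x)
      - of_real t' * of_nat b * radial_deriv j s (a + 2) (b + 1) (m x) (t x))
    + of_nat b * (- of_real (m x * m') * radial_deriv (Suc j) s (a + 1) (b + 1) (m x) (t x)
      - of_real t' * of_nat (b + 1) * radial_deriv j s (a + 1) (b + 1 + 1) (m x) (t x))) (at x)"
    by (intro has_vector_derivative_add has_vector_derivative_mult_right Suc.IH)
  then show ?case
    unfolding radial_deriv.simps(2)[of "Suc j"] radial_deriv.simps(2)[of j s a "b + 1"]
      radial_deriv.simps(2)[of j s a b]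
    by (rule has_vector_derivative_eq_rhs) (simp add: algebra_simps del: radial_deriv.simps)
qed

lemma isCont_radial_deriv: "isCont (\<lambda>s. radial_deriv j s a b m t) s"
  by (induction j arbitrary: a b) (auto intro!: continuous_intros)

text \<open>Each iterate is a finite sum of \<open>exp (- s * m)\<close> times inverse powers,
  bounded where \<open>m\<close> and \<open>m + t\<close> stay above \<open>\<delta>\<close>. This
  yields both the domination and the vanishing at infinity used for the integral.\<close>

lemma radial_deriv_bound:
  assumes "\<delta> > 0"
  obtains C where "C \<ge> 0"
    "\<And>m t. m \<ge> \<delta> \<Longrightarrow> m + t \<ge> \<delta> \<Longrightarrow> norm (radial_deriv j s a b m t) \<le> C * exp (- Re s * m)"
proof -
  have "\<exists>C\<ge>0. \<forall>m t. m \<ge> \<delta> \<longrightarrow> m + t \<ge> \<delta> \<longrightarrow> norm (radial_deriv j s a b m t) \<le> C * exp (- Re s * m)"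
  proof (induction j arbitrary: a b)
    case 0
    show ?case
    proof (intro exI[of _ "inverse \<delta> ^ a * inverse \<delta> ^ b"] conjI allI impI)
      fix m t :: real assume "m \<ge> \<delta>" "m + t \<ge> \<delta>"
      then have "inverse m ^ a * inverse (m + t) ^ b \<le> inverse \<delta> ^ a * inverse \<delta> ^ b"
        using assms by (intro mult_mono power_mono le_imp_inverse_le) auto
      moreover have "\<bar>m\<bar> = m" "\<bar>m + t\<bar> = m + t"
        using \<open>m \<ge> \<delta>\<close> \<open>m + t \<ge> \<delta>\<close> assms by auto
      ultimately show "norm (radial_deriv 0 s a b m t) \<le> inverse \<delta> ^ a * inverse \<delta> ^ b * exp (- Re s * m)"
        by (simp add: norm_mult norm_power norm_inverse mult.commute[of "exp _"] mult_right_mono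
            del: of_real_add of_real_mult of_real_inverse of_real_power)
    qed (use assms in auto)
  next
    case (Suc j)
    obtain C1 where C1: "C1 \<ge> 0" "\<And>m t. m \<ge> \<delta> \<Longrightarrow> m + t \<ge> \<delta> \<Longrightarrow>
        norm (radial_deriv j s (a + 1) b m t) \<le> C1 * exp (- Re s * m)" using Suc by blast
    obtain C2 where C2: "C2 \<ge> 0" "\<And>m t. m \<ge> \<delta> \<Longrightarrow> m + t \<ge> \<delta> \<Longrightarrow>
        norm (radial_deriv j s (a + 2) b m t) \<le> C2 * exp (- Re s * m)" using Suc by blast
    obtain C3 where C3: "C3 \<ge> 0" "\<And>m t. m \<ge> \<delta> \<Longrightarrow> m + t \<ge> \<delta> \<Longrightarrow>
        norm (radial_deriv j s (a + 1) (b + 1) m t) \<le> C3 * exp (- Re s * m)" using Suc by blast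
    show ?case
    proof (intro exI[of _ "norm s * C1 + real a * C2 + real b * C3"] conjI allI impI)
      fix m t :: real assume *: "m \<ge> \<delta>" "m + t \<ge> \<delta>"
      have "norm (radial_deriv (Suc j) s a b m t) \<le> norm s * (C1 * exp (- Re s * m))
          + real a * (C2 * exp (- Re s * m)) + real b * (C3 * exp (- Re s * m))"
        unfolding radial_deriv.simps(2)
        by (intro norm_triangle_mono) (auto simp only: norm_mult norm_of_nat
            intro!: mult_left_mono C1(2) C2(2) C3(2) * norm_ge_zero of_nat_0_le_iff)
      then show "norm (radial_deriv (Suc j) s a b m t)
          \<le> (norm s * C1 + real a * C2 + real b * C3) * exp (- Re s * m)"
        by (simp only: ring_distribs mult_ac)
    qed (use C1 C2 C3 in auto)
  qed
  then show thesis using that by blast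
qed

section \<open>The integral \<open>\<psi>\<close> and the function \<open>G_imp\<close>\<close>

lemma powr_half_integer:
  fixes w :: complex
  assumes "w \<noteq> 0"
  shows "w powr of_real (real n - 1 / 2) = w ^ n * w powr (- (1 / 2))"
proof -
  have "w powr (of_nat n + - (1 / 2)) = w powr of_nat n * w powr (- (1 / 2))"
    by (rule powr_add)
  then show ?thesis using assms by (simp add: powr_nat')
qed

lemma powr_half_divide_2:
  fixes w :: complex
  assumes "w \<noteq> 0"
  shows "(w / 2) powr (- (1 / 2)) = of_real (sqrt 2) * w powr (- (1 / 2))"
proof -
  have "Ln (w / of_real 2) = Ln w - of_real (ln 2)"
    using assms by (intro Ln_divide_of_real) auto
  then have L: "Ln (w / 2) = Ln w - of_real (ln 2)" by simp
  have "(w / 2) powr (- (1 / 2)) = exp (- (1 / 2) * (Ln w - of_real (ln 2)))"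
    using assms by (simp add: powr_def L)
  also have "- (1 / 2) * (Ln w - of_real (ln 2)) = of_real (ln 2 / 2) + - (1 / 2) * Ln w"
    by (simp add: algebra_simps)
  finally have "(w / 2) powr (- (1 / 2)) = exp (of_real (ln 2 / 2) + - (1 / 2) * Ln w)" .
  also have "\<dots> = of_real (exp (ln 2 / 2)) * w powr (- (1 / 2))"
    using assms by (simp only: exp_add powr_def exp_of_real if_False)
  also have "exp (ln 2 / 2) = sqrt 2"
    using powr_half_sqrt[of 2] by (simp add: powr_def)
  finally show ?thesis .
qed

text \<open>For \<open>Re s > 0\<close> the argument of \<open>s\<close> is below
  \<open>pi / 2\<close> in modulus, so \<open>2 * Ln s\<close> stays in the principal strip and
  equals \<open>Ln (s^2)\<close>.\<close>

lemma powr_square_half_integer: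
  fixes s :: complex
  assumes "Re s > 0"
  shows "(s\<^sup>2 / (2 * of_real pi)) powr of_real (real n + 1 / 2) =
    s ^ (2 * n + 1) / ((2 * of_real pi) ^ n * of_real (sqrt (2 * pi)))"
proof -
  have s0: "s \<noteq> 0" using assms by auto
  have "\<bar>Im (Ln s)\<bar> < pi / 2"
    using Re_Ln_pos_lt[OF s0] assms by simp
  then have "Ln (exp (2 * Ln s)) = 2 * Ln s"
    by (intro Ln_exp) auto
  moreover have "exp (2 * Ln s) = s\<^sup>2"
    using s0 by (simp add: exp_double)
  ultimately have L: "Ln (s\<^sup>2) = 2 * Ln s" by simp
  have "Ln (s\<^sup>2 / of_real (2 * pi)) = Ln (s\<^sup>2) - of_real (ln (2 * pi))"
    using s0 by (intro Ln_divide_of_real) auto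
  then have L2: "Ln (s\<^sup>2 / (2 * of_real pi)) = 2 * Ln s - of_real (ln (2 * pi))"
    by (simp add: L)
  have "(s\<^sup>2 / (2 * of_real pi)) powr of_real (real n + 1 / 2) =
      exp (of_real (real n + 1 / 2) * (2 * Ln s - of_real (ln (2 * pi))))"
    using s0 by (simp add: powr_def L2)
  also have "of_real (real n + 1 / 2) * (2 * Ln s - of_real (ln (2 * pi))) =
      of_nat (2 * n + 1) * Ln s - of_real ((real n + 1 / 2) * ln (2 * pi))"
    by (simp add: algebra_simps)
  also have "exp \<dots> = exp (of_nat (2 * n + 1) * Ln s) / exp (of_real ((real n + 1 / 2) * ln (2 * pi)))"
    by (rule exp_diff)
  also have "exp (of_nat (2 * n + 1) * Ln s) = s ^ (2 * n + 1)"
    using s0 by (metis exp_Ln exp_of_nat_mult)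
  also have "exp (complex_of_real ((real n + 1 / 2) * ln (2 * pi))) = of_real ((2 * pi) powr (real n + 1 / 2))"
    by (simp only: exp_of_real) (simp add: powr_def)
  also have "(2 * pi) powr (real n + 1 / 2) = (2 * pi) ^ n * sqrt (2 * pi)"
    by (simp add: powr_add powr_realpow powr_half_sqrt)
  finally show ?thesis by simp
qed

lemma sqrt_half_pi: "sqrt (pi / 2) = sqrt (2 * pi) / 2"
  using real_sqrt_divide[of "2 * pi" 4] by simp

text \<open>The factor \<open>w powr (- (1 / 2))\<close> of the Bessel function cancels against the
  denominator, leaving only integer powers of \<open>s\<close> and no choice of branch.\<close>

lemma bessel_K_quotient:
  assumes s: "s \<noteq> 0" and m: "m > 0"
  shows "exp (s * of_real m) * bessel_K (of_real (real n + 1 / 2)) (s * of_real m)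
      / (s * of_real m) powr of_real (real n - 1 / 2) =
    of_real (sqrt (pi / 2)) * of_real m / s ^ (2 * n) * exp (s * of_real m) * radial_deriv n s 1 0 m t"
proof -
  define w where "w = s * of_real m"
  define p where "p = w powr (- (1 / 2))"
  have w: "w \<noteq> 0" using s m by (simp add: w_def)
  then have p: "p \<noteq> 0" by (simp add: p_def)
  have "sqrt pi / 2 * sqrt 2 = sqrt (pi / 2)"
    by (simp add: sqrt_half_pi real_sqrt_mult)
  then have c: "of_real (sqrt pi) / 2 * of_real (sqrt 2) = complex_of_real (sqrt (pi / 2))"
    by (metis of_real_divide of_real_mult of_real_numeral)
  have "bessel_K (of_real (real n + 1 / 2)) w = of_real (sqrt pi) / 2 * (of_real (sqrt 2) * p)
      * w ^ (n + 1) / s ^ (2 * n + 1) * radial_deriv n s 1 0 m t"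
    using bessel_K_half_integer[OF s m, of n t] powr_half_divide_2[OF w]
    by (simp add: w_def p_def)
  also have "\<dots> = (w ^ n * p) * (of_real (sqrt pi) / 2 * of_real (sqrt 2)) * (w / s) / s ^ (2 * n)
      * radial_deriv n s 1 0 m t"
    by (simp add: mult_ac)
  also have "w / s = of_real m" using s by (simp add: w_def)
  finally have K: "bessel_K (of_real (real n + 1 / 2)) w =
      (w ^ n * p) * (of_real (sqrt (pi / 2)) * of_real m / s ^ (2 * n) * radial_deriv n s 1 0 m t)"
    unfolding c by simp
  show ?thesis
    unfolding w_def[symmetric] K powr_half_integer[OF w] p_def[symmetric]
    using w p by simp
qed

section \<open>The explicit parametrization by \<open>y\<close> and the evaluation of
  \<open>psi\<close>\<close>

context
  fixes l :: "'n::finite" and z :: "real ^ 'n" and a r :: real and U M T :: "real \<Rightarrow> real"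
  assumes z: "z \<in> H_plus l"
  defines "a \<equiv> norm z + z $ l" and "r \<equiv> (norm (tang l z))\<^sup>2"
    and "U \<equiv> \<lambda>y. y + a" and "M \<equiv> \<lambda>y. (U y + r / U y) / 2" and "T \<equiv> \<lambda>y. (U y - r / U y) / 2"
begin

lemma param_initial:
  shows "a > 0" "r \<ge> 0" "r / a = norm z - z $ l" "M 0 = norm z" "T 0 = z $ l" "r \<le> a\<^sup>2"
proof -
  have zl: "z $ l > 0" using z by (simp add: H_plus_def)
  show a: "a > 0" using zl by (simp add: a_def add_nonneg_pos)
  show "r \<ge> 0" by (simp add: r_def)
  have "r = (norm z - z $ l) * a"
    using norm_tang[of l z] by (simp add: r_def a_def power2_eq_square algebra_simps)
  then show ra: "r / a = norm z - z $ l" using a by simp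
  show "M 0 = norm z" "T 0 = z $ l"
    by (simp_all add: M_def T_def U_def ra) (simp_all add: a_def)
  show "r \<le> a\<^sup>2"
    unfolding \<open>r = _\<close> power2_eq_square using a zl by (intro mult_right_mono) (auto simp: a_def)
qed

lemma param_relations:
  assumes "y \<ge> 0"
  shows "U y \<ge> a" "U y > 0" "T y \<ge> z $ l" "T y > 0" "M y > 0" "M y \<ge> a / 2" "M y \<le> U y"
    "T y + M y = U y" "r + (T y)\<^sup>2 = (M y)\<^sup>2"
proof -
  note p = param_initial
  show U: "U y \<ge> a" "U y > 0" using assms p by (auto simp: U_def)
  have "r / U y \<le> r / a" using p U by (intro divide_left_mono) auto
  then have "T y \<ge> T 0"
    using U unfolding T_def by (auto simp: U_def)
  then show T: "T y \<ge> z $ l" by (simp add: p)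
  then show "T y > 0" using z by (simp add: H_plus_def)
  show TM: "T y + M y = U y" by (simp add: T_def M_def flip: add_divide_distrib)
  then show "M y \<le> U y" using \<open>T y > 0\<close> by simp
  have "r / U y \<ge> 0" using p U by simp
  then show "M y \<ge> a / 2" using U by (simp add: M_def)
  then show "M y > 0" using p(1) by simp
  \<comment> \<open>The squares of half the sum and half the difference of \<open>U\<close> and
    \<open>q\<close> differ by \<open>q * U\<close>, which is \<open>r\<close> for
    \<open>q = r / U\<close>.\<close>
  have "q * U y + ((U y - q) / 2)\<^sup>2 = ((U y + q) / 2)\<^sup>2" for q
    by (simp add: power2_eq_square field_simps)
  from this[of "r / U y"] show "r + (T y)\<^sup>2 = (M y)\<^sup>2"
    using U by (simp add: T_def M_def)
qed

text \<open>\<open>M^2 = r + T^2\<close> and \<open>T + M = y + a\<close> say that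
  \<open>y_fun\<close> maps \<open>T y\<close> to \<open>y\<close>; injectivity on the half-line
  then identifies the inverse.\<close>

lemma t_fun_mu_tilde:
  assumes y: "y \<ge> 0"
  shows "t_fun l z y = T y" "mu_tilde l z y = M y"
proof -
  note n = param_relations[OF y]
  have mu: "mu l z (T y) = M y"
    unfolding mu_def r_def[symmetric] n(9) using n(5) by simp
  have "y_fun l z (T y) = y"
    unfolding y_fun_def mu using n(8) by (simp add: U_def a_def)
  then show t: "t_fun l z y = T y"
    unfolding t_fun_def using n(3) y_fun_bij[OF z]
    by (intro the_inv_into_f_eq) (auto simp: bij_betw_def)
  show "mu_tilde l z y = M y" by (simp add: mu_tilde_def t mu)
qed

text \<open>Because \<open>M y - y = a - T y\<close>, the factor \<open>exp (s * a)\<close> leaves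
  the integral. What remains is in effect an integral over \<open>t\<close>, with
  \<open>M / U\<close> as the derivative of \<open>T\<close>.\<close>

lemma psi_eq:
  assumes s: "s \<noteq> 0"
  shows "psi (real n) s l z = of_real (sqrt (pi / 2)) / s ^ (2 * n) * exp (s * of_real a) *
    (LINT y:{0..}|lborel. of_real (M y / U y) * exp (- s * of_real (T y)) * radial_deriv n s 1 0 (M y) (T y))"
    (is "_ = ?C * (LINT y:{0..}|lborel. ?f y)")
proof -
  have "psi (real n) s l z = (LINT y:{0..}|lborel. ?C * ?f y)"
    unfolding psi_def
  proof (rule set_lebesgue_integral_cong, simp, intro allI impI)
    fix y :: real assume "y \<in> {0..}"
    then have y: "y \<ge> 0" by simp
    note n = param_relations[OF y]
    have "- s * of_real y + s * of_real (M y) = s * of_real a + - s * of_real (T y)"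
    proof -
      have "M y - y = a - T y" using n(8) by (simp add: U_def)
      then have "s * of_real (M y - y) = s * of_real (a - T y)" by simp
      then show ?thesis by (simp add: algebra_simps)
    qed
    then have e: "exp (- s * of_real y) * exp (s * of_real (M y)) = exp (s * of_real a) * exp (- s * of_real (T y))"
      by (simp only: flip: exp_add)
    have "exp (- s * of_real y) / of_real (U y) *
       (of_real (sqrt (pi / 2)) * of_real (M y) / s ^ (2 * n) * exp (s * of_real (M y)) * radial_deriv n s 1 0 (M y) (T y)) =
       (exp (- s * of_real y) * exp (s * of_real (M y))) * (of_real (sqrt (pi / 2)) / s ^ (2 * n)
        * (of_real (M y / U y) * radial_deriv n s 1 0 (M y) (T y)))"
      by (simp add: mult_ac)
    also have "\<dots> = ?C * ?f y"
      unfolding e by (simp only: mult_ac)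
    finally show "(let t = t_fun l z y; m = mu_tilde l z y
         in exp (- s * of_real y) / of_real (t + m) *
            (exp (s * of_real m) * bessel_K (of_real (real n + 1/2)) (s * of_real m)
               / (s * of_real m) powr of_real (real n - 1/2))) = ?C * ?f y"
      unfolding Let_def t_fun_mu_tilde[OF y] n(8) bessel_K_quotient[OF s n(5), of n "T y"] .
  qed
  then show ?thesis by (simp only: set_integral_mult_right)
qed

lemma param_derivatives:
  assumes "y \<ge> 0"
  shows "(M has_real_derivative T y / U y) (at y)" "(T has_real_derivative M y / U y) (at y)"
proof -
  have U: "(U has_real_derivative 1) (at y)"
    unfolding U_def by (auto intro!: derivative_eq_intros)
  have "U y \<noteq> 0" using param_relations(2)[OF assms] by simp
  then show "(M has_real_derivative T y / U y) (at y)" "(T has_real_derivative M y / U y) (at y)"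
    unfolding M_def T_def by (auto intro!: derivative_eq_intros U simp: field_simps)
qed

lemma exp_T_derivative:
  fixes s :: complex
  assumes "y \<ge> 0"
  shows "((\<lambda>y. exp (- s * of_real (T y))) has_vector_derivative
    - s * of_real (M y / U y) * exp (- s * of_real (T y))) (at y)"
proof -
  have "((\<lambda>w. exp (- s * w)) has_field_derivative (- s) * exp (- s * of_real (T y))) (at (of_real (T y)))"
    by (auto intro!: derivative_eq_intros)
  then have "((\<lambda>w. exp (- s * w)) \<circ> (\<lambda>y. of_real (T y)) has_vector_derivative
      of_real (M y / U y) * ((- s) * exp (- s * of_real (T y)))) (at y)"
    using param_derivatives(2)[OF assms]
    by (intro field_vector_diff_chain_at has_vector_derivative_of_real)
      (auto simp: has_real_derivative_iff_has_vector_derivative)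
  then show ?thesis by (simp add: o_def mult_ac)
qed

text \<open>Since \<open>T + M = y + a\<close>, the two exponentials combine into decay in
  \<open>y\<close> alone.\<close>

lemma param_bound:
  assumes "y \<ge> 0" "norm R \<le> C * exp (- Re s * M y)"
  shows "norm (exp (- s * of_real (T y)) * R) \<le> C * exp (- Re s * a) * exp (- Re s * y)"
proof -
  have "norm (exp (- s * of_real (T y)) * R) \<le> exp (- Re s * T y) * (C * exp (- Re s * M y))"
    using assms by (simp add: norm_mult)
  also have "\<dots> = C * exp (- Re s * T y + - Re s * M y)"
    by (simp only: exp_add mult_ac)
  also have "- Re s * T y + - Re s * M y = - Re s * a + - Re s * y"
    using param_relations(8)[OF assms(1)] unfolding U_def by (metis add.commute distrib_left)
  finally show ?thesis by (simp only: exp_add mult_ac)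
qed

text \<open>By \<open>radial_deriv_raise\<close> with \<open>b = 0\<close>, the integrand is the
  derivative of \<open>- exp (- s * T) * R k 1\<close>. Only the boundary term at
  \<open>y = 0\<close>, where \<open>M = norm z\<close> and \<open>T = z $ l\<close>,
  survives.\<close>

lemma psi_Suc:
  assumes s: "Re s > 0"
  shows "psi (real (Suc k)) s l z = of_real (sqrt (pi / 2)) / s ^ (2 * Suc k) * exp (s * of_real (norm z))
    * radial_deriv k s 1 1 (norm z) (z $ l)"
proof -
  define R where "R j b y = radial_deriv j s 1 b (M y) (T y)" for j b y
  note p = param_initial
  have s0: "s \<noteq> 0" using s by auto
  have R': "(R j b has_vector_derivative - of_real (M y * (T y / U y)) * R (Suc j) b y
      - of_real (M y / U y) * of_nat b * R j (b + 1) y) (at y)" if "y \<ge> 0" for j b y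
    unfolding R_def using param_relations[OF that]
    by (intro has_vector_derivative_radial_deriv param_derivatives that) auto
  have Rb: "\<exists>C\<ge>0. \<forall>y\<ge>0. norm (R j b y) \<le> C * exp (- Re s * M y)" for j b
  proof -
    \<comment> \<open>The threshold \<open>a / 2\<close> serves both conditions, as
      \<open>M \<ge> a / 2\<close> and \<open>M + T = U \<ge> a\<close>.\<close>
    obtain C where C: "C \<ge> 0" "\<And>m t. m \<ge> a / 2 \<Longrightarrow> m + t \<ge> a / 2 \<Longrightarrow>
        norm (radial_deriv j s 1 b m t) \<le> C * exp (- Re s * m)"
      using radial_deriv_bound[of "a / 2" j s 1 b] p(1) by auto
    have "norm (R j b y) \<le> C * exp (- Re s * M y)" if "y \<ge> 0" for y
      unfolding R_def using param_relations[OF that] p(1) by (intro C(2)) auto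
    then show ?thesis using C(1) by blast
  qed
  let ?f = "\<lambda>y. of_real (M y / U y) * exp (- s * of_real (T y)) * R (Suc k) 0 y"
  let ?F = "\<lambda>y. - (exp (- s * of_real (T y)) * R k 1 y)"
  obtain C where C: "C \<ge> 0" "\<And>y. y \<ge> 0 \<Longrightarrow> norm (R (Suc k) 0 y) \<le> C * exp (- Re s * M y)"
    using Rb[of "Suc k" 0] by blast
  obtain D where D: "D \<ge> 0" "\<And>y. y \<ge> 0 \<Longrightarrow> norm (R k 1 y) \<le> D * exp (- Re s * M y)"
    using Rb[of k 1] by blast
  have "(LINT y:{0..}|lborel. ?f y) = - ?F 0"
  proof (rule set_integral_FTC_to_infinity[where c = "Re s" and C = "C * exp (- Re s * a)"])
    show "Re s > 0" by (fact s)
    have "isCont ?f y" if y: "y \<ge> 0" for y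
    proof -
      have "isCont (\<lambda>y. exp (- s * of_real (T y))) y" "isCont (R (Suc k) 0) y"
        using exp_T_derivative[OF y] R'[OF y] has_vector_derivative_continuous by blast+
      moreover have "isCont (\<lambda>y. M y / U y) y"
        using param_relations(2)[OF y] DERIV_isCont[OF param_derivatives(1)[OF y]]
        by (intro continuous_intros) (auto simp: U_def intro!: continuous_intros)
      then have "isCont (\<lambda>y. complex_of_real (M y / U y)) y" by (rule continuous_of_real)
      ultimately show ?thesis by (intro continuous_mult)
    qed
    then show "continuous_on {0..} ?f" by (intro continuous_at_imp_continuous_on) auto
  next
    fix y :: real assume y: "y \<ge> 0"
    note n = param_relations[OF y]
    have "norm (of_real (M y / U y) :: complex) \<le> 1"
      unfolding norm_of_real using n by simp
    moreover have "norm (exp (- s * of_real (T y)) * R (Suc k) 0 y) \<le> C * exp (- Re s * a) * exp (- Re s * y)"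
      by (rule param_bound[OF y C(2)[OF y]])
    ultimately have "norm (of_real (M y / U y) * (exp (- s * of_real (T y)) * R (Suc k) 0 y))
        \<le> 1 * (C * exp (- Re s * a) * exp (- Re s * y))"
      unfolding norm_mult[of "of_real (M y / U y)"] by (intro mult_mono) auto
    then show "norm (?f y) \<le> C * exp (- Re s * a) * exp (- Re s * y)"
      by (simp add: mult.assoc)
    have raise: "s * R k 1 y + of_real (T y) * R (Suc k) 1 y + R k 2 y = R (Suc k) 0 y"
      using radial_deriv_raise[of "M y" "T y" s k 0] n unfolding R_def
      by (simp add: add_ac numeral_2_eq_2 del: radial_deriv.simps)
    have "(?F has_vector_derivative - (exp (- s * of_real (T y)) *
        (- of_real (M y * (T y / U y)) * R (Suc k) 1 y - of_real (M y / U y) * of_nat 1 * R k (1 + 1) y)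
        + (- s * of_real (M y / U y) * exp (- s * of_real (T y))) * R k 1 y)) (at y)"
      by (intro has_vector_derivative_minus has_vector_derivative_mult exp_T_derivative y R')
    moreover have "- (exp (- s * of_real (T y)) *
        (- of_real (M y * (T y / U y)) * R (Suc k) 1 y - of_real (M y / U y) * of_nat 1 * R k (1 + 1) y)
        + (- s * of_real (M y / U y) * exp (- s * of_real (T y))) * R k 1 y) = ?f y"
    proof -
      have "- (exp (- s * of_real (T y)) *
        (- of_real (M y * (T y / U y)) * R (Suc k) 1 y - of_real (M y / U y) * of_nat 1 * R k (1 + 1) y)
        + (- s * of_real (M y / U y) * exp (- s * of_real (T y))) * R k 1 y) =
        of_real (M y / U y) * exp (- s * of_real (T y)) *
        (s * R k 1 y + of_real (T y) * R (Suc k) 1 y + R k 2 y)"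
        by (simp add: algebra_simps numeral_2_eq_2 add_divide_distrib)
      then show ?thesis unfolding raise .
    qed
    ultimately show "(?F has_vector_derivative ?f y) (at y)" by simp
  next
    have "((\<lambda>y. D * exp (- Re s * a) * exp (- Re s * y)) \<longlongrightarrow> 0) at_top"
      using s by real_asymp
    moreover have "\<forall>\<^sub>F y in at_top. norm (?F y) \<le> D * exp (- Re s * a) * exp (- Re s * y)"
      using eventually_ge_at_top[of 0]
    proof eventually_elim
      case (elim y)
      show ?case unfolding norm_minus_cancel by (rule param_bound[OF elim D(2)[OF elim]])
    qed
    ultimately show "(?F \<longlongrightarrow> 0) at_top" by (rule Lim_null_comparison[rotated])
  qed
  also have "- ?F 0 = exp (- s * of_real (z $ l)) * radial_deriv k s 1 1 (norm z) (z $ l)"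
    by (simp add: R_def p)
  finally have I: "(LINT y:{0..}|lborel. ?f y) = exp (- s * of_real (z $ l)) * radial_deriv k s 1 1 (norm z) (z $ l)" .
  have e: "exp (s * of_real a) * exp (- s * of_real (z $ l)) = exp (s * of_real (norm z))"
    by (simp add: a_def algebra_simps flip: exp_add)
  show ?thesis
    unfolding psi_eq[OF s0] R_def[symmetric] I e[symmetric] by (simp only: mult_ac)
qed

lemma psi_0:
  assumes s: "Re s > 0"
  shows "psi (real 0) s l z = of_real (sqrt (pi / 2)) * exp_stieltjes (s * of_real a)"
proof -
  note p = param_initial
  have s0: "s \<noteq> 0" using s by auto
  have off_cut: "s * of_real x \<in> - \<real>\<^sub>\<le>\<^sub>0" if "x > 0" for x
    using s that by (auto simp: complex_nonpos_Reals_iff zero_less_mult_iff mult_le_0_iff)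
  let ?f = "\<lambda>y. exp (- s * of_real y) / of_real (U y)"
  let ?F = "\<lambda>y. - (exp (- s * of_real y) * exp_stieltjes (s * of_real (U y)))"
  define B :: real where "B = (LINT x:{0..}|lborel. exp (- 1 * x))"
  \<comment> \<open>The real part of the denominator is at least \<open>Re s * a\<close>. The
    resulting bound is uniform in \<open>x\<close>, so the factor \<open>exp (- s * y)\<close> makes
    the boundary term vanish at infinity.\<close>
  have St: "norm (exp_stieltjes (s * of_real x)) \<le> 1 / (Re s * a) * B" if x: "x \<ge> a" for x
    unfolding exp_stieltjes_def B_def
  proof (rule set_integral_exp_bound)
    have x0: "x > 0" using x p by simp
    show "continuous_on {0..} (\<lambda>t. of_real (exp (- t)) / (s * of_real x + of_real t))"
      using slit_add_nonneg_neq_0[OF off_cut[OF x0]] by (intro continuous_intros) auto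
    fix t :: real assume t: "t \<ge> 0"
    have "Re s * a \<le> Re s * x + t" using s x t by (simp add: add_increasing2)
    also have "\<dots> = Re (s * of_real x + of_real t)" by simp
    also have "\<dots> \<le> norm (s * of_real x + of_real t)" by (rule complex_Re_le_cmod)
    finally have "exp (- t) / norm (s * of_real x + of_real t) \<le> exp (- t) / (Re s * a)"
      using s p by (intro divide_left_mono) (auto intro!: mult_pos_pos intro: less_le_trans)
    then show "norm (of_real (exp (- t)) / (s * of_real x + of_real t)) \<le> 1 / (Re s * a) * exp (- 1 * t)"
      by (simp add: norm_divide)
  qed simp
  have "(LINT y:{0..}|lborel. ?f y) = - ?F 0"
  proof (rule set_integral_FTC_to_infinity[where c = "Re s" and C = "1 / a"])
    show "Re s > 0" by (fact s)
    have "complex_of_real (U y) \<noteq> 0" if "y \<ge> 0" for y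
      using param_relations(2)[OF that] by simp
    then show "continuous_on {0..} ?f"
      unfolding U_def by (intro continuous_intros) auto
  next
    fix y :: real assume y: "y \<ge> 0"
    note n = param_relations[OF y]
    have "exp (- Re s * y) / U y \<le> exp (- Re s * y) / a"
      using n p by (intro divide_left_mono) auto
    then show "norm (?f y) \<le> 1 / a * exp (- Re s * y)"
      using n by (simp add: norm_divide)
    have "((\<lambda>w. - (exp (- s * w) * exp_stieltjes (s * (w + of_real a)))) has_field_derivative
      - (exp (- s * of_real y) * ((exp_stieltjes (s * (of_real y + of_real a)) - 1 / (s * (of_real y + of_real a))) * s)
         + - s * exp (- s * of_real y) * exp_stieltjes (s * (of_real y + of_real a)))) (at (of_real y))"
    proof (rule DERIV_minus, rule DERIV_cong[OF DERIV_mult])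
      have "s * (of_real y + of_real a) \<in> - \<real>\<^sub>\<le>\<^sub>0"
        using off_cut[OF n(2)] by (simp add: U_def)
      then show "((\<lambda>w. exp_stieltjes (s * (w + of_real a))) has_field_derivative
        (exp_stieltjes (s * (of_real y + of_real a)) - 1 / (s * (of_real y + of_real a))) * s) (at (of_real y))"
        by (rule DERIV_chain2[OF has_field_derivative_exp_stieltjes]) (auto intro!: derivative_eq_intros)
      show "((\<lambda>w. exp (- s * w)) has_field_derivative - s * exp (- s * of_real y)) (at (of_real y))"
        by (auto intro!: derivative_eq_intros)
    qed simp
    also have "- (exp (- s * of_real y) * ((exp_stieltjes (s * (of_real y + of_real a)) - 1 / (s * (of_real y + of_real a))) * s)
         + - s * exp (- s * of_real y) * exp_stieltjes (s * (of_real y + of_real a))) = ?f y"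
    proof -
      have "- (e * ((F - 1 / (s * q)) * s) + - s * e * F) = e / q" if "q \<noteq> 0" for e F q
        using that s0 by (simp add: field_simps)
      moreover have "complex_of_real y + of_real a \<noteq> 0"
        using n(2) unfolding U_def by (metis of_real_add of_real_eq_0_iff less_irrefl)
      ultimately show ?thesis by (simp only: U_def of_real_add)
    qed
    finally show "(?F has_vector_derivative ?f y) (at y)"
      using has_vector_derivative_real_field by (fastforce simp: U_def)
  next
    have "((\<lambda>y. exp (- Re s * y) * (1 / (Re s * a) * B)) \<longlongrightarrow> 0) at_top"
      using s by real_asymp
    moreover have "\<forall>\<^sub>F y in at_top. norm (?F y) \<le> exp (- Re s * y) * (1 / (Re s * a) * B)"
      using eventually_ge_at_top[of 0]
    proof eventually_elim
      case (elim y)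
      have "norm (?F y) = exp (- Re s * y) * norm (exp_stieltjes (s * of_real (U y)))"
        by (simp add: norm_mult)
      also have "\<dots> \<le> exp (- Re s * y) * (1 / (Re s * a) * B)"
        by (intro mult_left_mono St param_relations(1)[OF elim]) simp
      finally show ?case .
    qed
    ultimately show "(?F \<longlongrightarrow> 0) at_top" by (rule Lim_null_comparison[rotated])
  qed
  also have "- ?F 0 = exp_stieltjes (s * of_real a)" by (simp add: U_def)
  finally have I: "(LINT y:{0..}|lborel. ?f y) = exp_stieltjes (s * of_real a)" .
  have "psi (real 0) s l z = of_real (sqrt (pi / 2)) * (exp (s * of_real a) *
    (LINT y:{0..}|lborel. of_real (M y / U y) * exp (- s * of_real (T y)) * radial_deriv 0 s 1 0 (M y) (T y)))"
    unfolding psi_eq[OF s0] by simp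
  also have "exp (s * of_real a) * (LINT y:{0..}|lborel. of_real (M y / U y) * exp (- s * of_real (T y)) * radial_deriv 0 s 1 0 (M y) (T y))
    = (LINT y:{0..}|lborel. exp (s * of_real a) * (of_real (M y / U y) * exp (- s * of_real (T y)) * radial_deriv 0 s 1 0 (M y) (T y)))"
    by (rule set_integral_mult_right[symmetric])
  \<comment> \<open>Without radial derivatives the last factor is \<open>exp (- s * M) / M\<close>:
    \<open>M\<close> cancels against \<open>M / U\<close>, and the exponents add up to
    \<open>- s * y\<close>.\<close>
  also have "\<dots> = (LINT y:{0..}|lborel. ?f y)"
  proof (rule set_lebesgue_integral_cong, simp, intro allI impI)
    fix y :: real assume "y \<in> {0..}"
    then have y: "y \<ge> 0" by simp
    note n = param_relations[OF y]
    have "s * of_real a + (- s * of_real (T y) + - s * of_real (M y)) = - s * of_real y"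
    proof -
      have "a - (T y + M y) = - y" using n(8) by (simp add: U_def)
      then have "s * of_real (a - (T y + M y)) = s * of_real (- y)" by simp
      then show ?thesis by (simp add: algebra_simps)
    qed
    then have e: "exp (s * of_real a) * (exp (- s * of_real (T y)) * exp (- s * of_real (M y))) = exp (- s * of_real y)"
      by (simp only: flip: exp_add)
    have "exp (s * of_real a) * (of_real (M y / U y) * exp (- s * of_real (T y)) * radial_deriv 0 s 1 0 (M y) (T y)) =
      (exp (s * of_real a) * (exp (- s * of_real (T y)) * exp (- s * of_real (M y)))) / of_real (U y)"
      using n by simp
    then show "exp (s * of_real a) * (of_real (M y / U y) * exp (- s * of_real (T y)) * radial_deriv 0 s 1 0 (M y) (T y)) = ?f y"
      unfolding e .
  qed
  finally show ?thesis unfolding I .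
qed

end

section \<open>Closed forms of \<open>G_imp\<close> in the open right half-plane of
  \<open>s\<close>\<close>

lemma G_imp_rhp_0:
  fixes l :: "'n::finite" and z :: "real ^ 'n"
  assumes "z \<in> H_plus l" "CARD('n) = 3" "Re s > 0"
  shows "G_imp_rhp s l z = - (s / (2 * of_real pi)) * exp (- s * of_real (norm z))
    * exp_stieltjes (s * of_real (norm z + z $ l))"
proof -
  have \<nu>: "(real CARD('n) - 3) / 2 = real 0" using assms(2) by simp
  have "sqrt (2 * pi) \<noteq> 0" by simp
  then have nz: "complex_of_real (sqrt (2 * pi)) \<noteq> 0" by (simp only: of_real_eq_0_iff not_False_eq_True)
  show ?thesis
    unfolding G_imp_rhp_def Let_def \<nu> psi_0[OF assms(1,3)] powr_square_half_integer[OF assms(3)]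
      sqrt_half_pi of_real_divide using nz by (simp add: field_simps)
qed

lemma G_imp_rhp_Suc:
  fixes l :: "'n::finite" and z :: "real ^ 'n"
  assumes "z \<in> H_plus l" "(real CARD('n) - 3) / 2 = real (Suc k)" "Re s > 0"
  shows "G_imp_rhp s l z =
    - (s / (2 * of_real pi) ^ (Suc k + 1)) * radial_deriv k s 1 1 (norm z) (z $ l)"
proof -
  have "sqrt (2 * pi) \<noteq> 0" by simp
  then have nz: "complex_of_real (sqrt (2 * pi)) \<noteq> 0" by (simp only: of_real_eq_0_iff not_False_eq_True)
  have s0: "s \<noteq> 0" using assms(3) by auto
  define R where "R = radial_deriv k s 1 1 (norm z) (z $ l)"
  define E where "E = exp (s * of_real (norm z))"
  have E: "exp (- s * of_real (norm z)) = 1 / E" "E \<noteq> 0" by (simp_all add: E_def exp_minus field_simps)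
  show ?thesis
    unfolding G_imp_rhp_def Let_def assms(2) psi_Suc[OF assms(1,3)] powr_square_half_integer[OF assms(3)]
      sqrt_half_pi of_real_divide R_def[symmetric] E E_def[symmetric]
    using nz s0 E(2) by (simp add: field_simps)
qed

section \<open>Iterating the differential expression on \<open>Psi\<close>\<close>

lemma partial_deriv_cong:
  assumes "z \<in> H_plus l" "\<And>w. w \<in> H_plus l \<Longrightarrow> f w = g w"
    and "((\<lambda>h. g (z + h *\<^sub>R axis l 1)) has_vector_derivative D) (at 0)"
  shows "partial_deriv l f z = D"
proof -
  have zl: "z $ l > 0" using assms(1) by (simp add: H_plus_def)
  have "((\<lambda>h. f (z + h *\<^sub>R axis l 1)) has_vector_derivative D) (at 0)"
  \<comment> \<open>For \<open>h > - z $ l\<close> the line through \<open>z\<close> stays in the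
    half-space, so \<open>f\<close> and \<open>g\<close> agree along it near
    \<open>h = 0\<close>.\<close>
  proof (rule has_vector_derivative_transform_within_open[OF assms(3)])
    show "g (z + h *\<^sub>R axis l 1) = f (z + h *\<^sub>R axis l 1)" if "h \<in> {- (z $ l)<..}" for h
      using that by (intro assms(2)[symmetric]) (simp add: H_plus_def axis_def)
  qed (use zl in auto)
  then show ?thesis unfolding partial_deriv_def by (rule vector_derivative_at)
qed

lemma norm_add_axis:
  "norm (z + h *\<^sub>R axis l 1) = sqrt ((norm (tang l z))\<^sup>2 + (z $ l + h)\<^sup>2)"
proof -
  have "tang l (z + h *\<^sub>R axis l 1) = tang l z"
    by (auto simp: tang_def vec_eq_iff axis_def)
  then have "(norm (z + h *\<^sub>R axis l 1))\<^sup>2 = (norm (tang l z))\<^sup>2 + (z $ l + h)\<^sup>2"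
    using norm_tang[of l "z + h *\<^sub>R axis l 1"] by (simp add: axis_def)
  then show ?thesis by (metis norm_ge_zero real_sqrt_abs2 power2_eq_square abs_norm_cancel)
qed

text \<open>A shift along the axis \<open>l\<close> fixes the tangential part, so
  \<open>norm z\<close> and \<open>z $ l\<close> move like \<open>m = sqrt (r + t^2)\<close> and
  \<open>t\<close>, with \<open>m * dm/dt = t\<close>. The result is then the left side of
  \<open>radial_deriv_raise\<close>.\<close>

lemma s_minus_partial_radial_deriv:
  assumes z: "z \<in> H_plus l" and f: "\<And>w. w \<in> H_plus l \<Longrightarrow> f w = c * radial_deriv j s 1 (b + 1) (norm w) (w $ l)"
  shows "s_minus_partial s l f z = c * radial_deriv (Suc j) s 1 b (norm z) (z $ l)"
proof -
  have zl: "z $ l > 0" using z by (simp add: H_plus_def)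
  then have nz: "norm z > 0" by auto
  then have nz2: "norm z + z $ l \<noteq> 0" using zl by linarith
  have n0: "(norm (tang l z))\<^sup>2 + (z $ l)\<^sup>2 = (norm z)\<^sup>2" by (rule norm_tang)
  have "((\<lambda>h. c * radial_deriv j s 1 (b + 1) (norm (z + h *\<^sub>R axis l 1)) ((z + h *\<^sub>R axis l 1) $ l))
      has_vector_derivative c * (- of_real (norm (z + 0 *\<^sub>R axis l 1) * (z $ l / norm z))
        * radial_deriv (Suc j) s 1 (b + 1) (norm (z + 0 *\<^sub>R axis l 1)) ((z + 0 *\<^sub>R axis l 1) $ l)
      - of_real 1 * of_nat (b + 1) * radial_deriv j s 1 (b + 1 + 1) (norm (z + 0 *\<^sub>R axis l 1)) ((z + 0 *\<^sub>R axis l 1) $ l)))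
      (at 0)"
  proof (intro has_vector_derivative_mult_right has_vector_derivative_radial_deriv)
    show "((\<lambda>h. norm (z + h *\<^sub>R axis l 1)) has_real_derivative z $ l / norm z) (at 0)"
      unfolding norm_add_axis using nz n0
      by (auto intro!: derivative_eq_intros simp: divide_simps)
    show "((\<lambda>h. (z + h *\<^sub>R axis l 1) $ l) has_real_derivative 1) (at 0)"
      by (auto intro!: derivative_eq_intros simp: axis_def)
  qed (use zl nz nz2 in auto)
  then have "partial_deriv l f z = c * (- of_real (norm (z + 0 *\<^sub>R axis l 1) * (z $ l / norm z))
        * radial_deriv (Suc j) s 1 (b + 1) (norm (z + 0 *\<^sub>R axis l 1)) ((z + 0 *\<^sub>R axis l 1) $ l)
      - of_real 1 * of_nat (b + 1) * radial_deriv j s 1 (b + 1 + 1) (norm (z + 0 *\<^sub>R axis l 1)) ((z + 0 *\<^sub>R axis l 1) $ l))"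
    by (rule partial_deriv_cong[where g = "\<lambda>w. c * radial_deriv j s 1 (b + 1) (norm w) (w $ l)", OF z, rotated])
      (rule f)
  then have pd: "partial_deriv l f z = c * (- of_real (z $ l) * radial_deriv (Suc j) s 1 (b + 1) (norm z) (z $ l)
      - of_nat (b + 1) * radial_deriv j s 1 (b + 2) (norm z) (z $ l))"
    using nz by (simp del: radial_deriv.simps)
  have "norm z \<noteq> 0" using nz by simp
  note raise = radial_deriv_raise[OF this nz2, of s j b]
  show ?thesis
    unfolding s_minus_partial_def pd f[OF z] raise[symmetric]
    by (simp add: algebra_simps del: radial_deriv.simps)
qed

lemma Psi_eq_radial_deriv:
  "Psi n s l z = - (s / (2 * of_real pi) ^ (n + 1)) * radial_deriv 0 s 1 n (norm z) (z $ l)"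
proof -
  have "inverse (norm z) ^ 1 * inverse (norm z + z $ l) ^ n = inverse ((norm z + z $ l) ^ n * norm z)"
    by (simp add: power_inverse)
  then show ?thesis
    unfolding Psi_def radial_deriv.simps by (simp only: of_real_inverse divide_inverse mult.assoc)
qed

text \<open>Each application trades one factor \<open>1 / (m + t)\<close> for one radial derivative.
  The induction keeps \<open>z\<close> arbitrary because the next derivative needs the formula in a
  neighbourhood.\<close>

lemma s_minus_partial_funpow_Psi:
  assumes "z \<in> H_plus l" "j \<le> n"
  shows "(s_minus_partial s l ^^ j) (Psi n s l) z =
    - (s / (2 * of_real pi) ^ (n + 1)) * radial_deriv j s 1 (n - j) (norm z) (z $ l)"
  using assms
proof (induction j arbitrary: z)
  case 0
  then show ?case by (simp add: Psi_eq_radial_deriv)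
next
  case (Suc j)
  have "n - j = n - Suc j + 1" using Suc.prems by simp
  then have "(s_minus_partial s l ^^ j) (Psi n s l) w =
      - (s / (2 * of_real pi) ^ (n + 1)) * radial_deriv j s 1 (n - Suc j + 1) (norm w) (w $ l)"
    if "w \<in> H_plus l" for w
    using Suc.IH[OF that] Suc.prems by simp
  from s_minus_partial_radial_deriv[OF Suc.prems(1) this]
  show ?case by simp
qed

text \<open>A formula valid in the open half-plane and continuous at \<open>s\<close> determines the
  boundary limit. The second conclusion records that this limit exists, which the value of
  \<open>Lim\<close> alone does not express.\<close>

lemma G_imp_extend:
  assumes s: "Re s > 0 \<or> (Re s = 0 \<and> s \<noteq> 0)"
    and g: "\<And>\<sigma>. Re \<sigma> > 0 \<Longrightarrow> G_imp_rhp \<sigma> l z = g \<sigma>" and cont: "isCont g s"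
  shows "G_imp s l z = g s"
    and "((\<lambda>\<sigma>. G_imp \<sigma> l z) \<longlongrightarrow> G_imp s l z) (at s within {\<sigma>. Re \<sigma> > 0})"
proof -
  let ?A = "at s within {\<sigma>. Re \<sigma> > 0}"
  have ev: "\<forall>\<^sub>F \<sigma> in ?A. Re \<sigma> > 0" by (simp add: eventually_at_filter)
  have lim: "(g \<longlongrightarrow> g s) ?A"
    using cont isCont_def tendsto_within_subset by blast
  have lim': "((\<lambda>\<sigma>. G_imp_rhp \<sigma> l z) \<longlongrightarrow> g s) ?A"
    using lim by (rule Lim_transform_eventually) (use ev in eventually_elim, simp add: g)
  \<comment> \<open>\<open>Lim\<close> is determined only along a nontrivial filter; the points
    \<open>s + e / 2\<close> approach \<open>s\<close> from inside the half-plane.\<close>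
  have nt: "?A \<noteq> bot"
  proof -
    have "s islimpt {\<sigma>. Re \<sigma> > 0}"
      unfolding islimpt_approachable
    proof (intro allI impI)
      fix e :: real assume "e > 0"
      then show "\<exists>x\<in>{\<sigma>. Re \<sigma> > 0}. x \<noteq> s \<and> dist x s < e"
        using s by (intro bexI[of _ "s + of_real (e / 2)"]) (auto simp: dist_norm norm_divide)
    qed
    then show ?thesis by (simp add: trivial_limit_within)
  qed
  show eq: "G_imp s l z = g s"
    using g tendsto_Lim[OF nt lim'] by (simp add: G_imp_def)
  show "((\<lambda>\<sigma>. G_imp \<sigma> l z) \<longlongrightarrow> G_imp s l z) ?A"
    unfolding eq using lim' by (rule Lim_transform_eventually)
      (use ev in eventually_elim, simp add: G_imp_def)
qed

theorem lemma4p1: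
  fixes l :: "'n::finite" and z :: "real ^ 'n" and s :: complex and \<nu> :: nat
  assumes "odd CARD('n)" and "CARD('n) \<ge> 3"
    and "\<nu> = (CARD('n) - 3) div 2"
    and "Re s > 0 \<or> (Re s = 0 \<and> s \<noteq> 0)"
    and "z \<in> H_plus l"
  shows "(Re s = 0 \<longrightarrow>
           ((\<lambda>\<sigma>. G_imp \<sigma> l z) \<longlongrightarrow> G_imp s l z) (at s within {\<sigma>. Re \<sigma> > 0})) \<and>
         (CARD('n) = 3 \<longrightarrow>
           G_imp s l z = - (s / (2 * of_real pi)) * exp (- s * of_real (norm z))
                           * tricomi_U 1 1 (s * of_real (norm z + z $ l))) \<and>
         (\<nu> \<ge> 1 \<longrightarrow>
           G_imp s l z = (s_minus_partial s l ^^ (\<nu> - 1)) (Psi \<nu> s l) z)"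
proof -
  \<comment> \<open>Oddness of the dimension makes the truncating division in \<open>\<nu>\<close>
    exact.\<close>
  have CARD: "CARD('n) = 2 * \<nu> + 3"
  proof -
    have "n = 2 * ((n - 3) div 2) + 3" if "odd n" "n \<ge> 3" for n :: nat
      using that by presburger
    from this[OF assms(1,2)] show ?thesis by (simp only: assms(3))
  qed
  show ?thesis
  proof (cases \<nu>)
    case 0
    then have 3: "CARD('n) = 3" using CARD by simp
    have a: "norm z + z $ l > 0" using assms(5) by (simp add: H_plus_def add_nonneg_pos)
    \<comment> \<open>For \<open>Re s > 0\<close> the real part is positive; on the punctured
      imaginary axis the imaginary part is nonzero. Either way the argument avoids the cut, so the
      formula is continuous there.\<close>
    have off_cut: "s * of_real (norm z + z $ l) \<in> - \<real>\<^sub>\<le>\<^sub>0"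
    proof (cases "Re s > 0")
      case True
      then have "Re s * (norm z + z $ l) > 0" using a by simp
      then show ?thesis by (simp add: complex_nonpos_Reals_iff del: of_real_add)
    next
      case False
      then have "Im s \<noteq> 0" using assms(4) by (auto simp: complex_eq_iff)
      then have "Im s * (norm z + z $ l) \<noteq> 0" using a by simp
      then show ?thesis by (simp add: complex_nonpos_Reals_iff del: of_real_add mult_eq_0_iff)
    qed
    have "isCont exp_stieltjes (s * of_real (norm z + z $ l))"
      by (rule DERIV_isCont[OF has_field_derivative_exp_stieltjes[OF off_cut]])
    then have "isCont (\<lambda>s. exp_stieltjes (s * of_real (norm z + z $ l))) s"
      by (rule isCont_o2[rotated]) (intro continuous_intros)
    moreover have "isCont (\<lambda>s. - (s / (2 * of_real pi)) * exp (- s * of_real (norm z))) s"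
      by (intro continuous_intros) simp
    ultimately have cont: "isCont (\<lambda>s. - (s / (2 * of_real pi)) * exp (- s * of_real (norm z))
        * exp_stieltjes (s * of_real (norm z + z $ l))) s"
      by (rule continuous_mult[rotated])
    note G = G_imp_extend[OF assms(4) G_imp_rhp_0[OF assms(5) 3] cont]
    show ?thesis
    proof (intro conjI impI)
      show "((\<lambda>\<sigma>. G_imp \<sigma> l z) \<longlongrightarrow> G_imp s l z) (at s within {\<sigma>. Re \<sigma> > 0})"
        by (rule G(2))
      show "G_imp s l z = - (s / (2 * of_real pi)) * exp (- s * of_real (norm z))
          * tricomi_U 1 1 (s * of_real (norm z + z $ l))"
        unfolding tricomi_U_1_1[OF off_cut] by (rule G(1))
    qed (use 0 in simp)
  next
    case (Suc k)
    then have c: "CARD('n) = 2 * Suc k + 3" using CARD by simp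
    then have n: "(real CARD('n) - 3) / 2 = real (Suc k)" by simp
    have cont: "isCont (\<lambda>s. - (s / (2 * of_real pi) ^ (Suc k + 1)) * radial_deriv k s 1 1 (norm z) (z $ l)) s"
      by (intro continuous_intros isCont_radial_deriv) simp
    note G = G_imp_extend[OF assms(4) G_imp_rhp_Suc[OF assms(5) n] cont]
    show ?thesis
    proof (intro conjI impI)
      show "((\<lambda>\<sigma>. G_imp \<sigma> l z) \<longlongrightarrow> G_imp s l z) (at s within {\<sigma>. Re \<sigma> > 0})"
        by (rule G(2))
      have "G_imp s l z = - (s / (2 * of_real pi) ^ (Suc k + 1)) * radial_deriv k s 1 1 (norm z) (z $ l)"
        by (rule G(1))
      \<comment> \<open>With \<open>k = \<nu> - 1\<close> applications to \<open>Psi \<nu>\<close>,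
        exactly one factor \<open>1 / (norm z + z $ l)\<close> is left, matching
        \<open>b = 1\<close>.\<close>
      also have "\<dots> = (s_minus_partial s l ^^ (\<nu> - 1)) (Psi \<nu> s l) z"
        using s_minus_partial_funpow_Psi[OF assms(5), of k "Suc k" s] Suc by simp
      finally show "G_imp s l z = (s_minus_partial s l ^^ (\<nu> - 1)) (Psi \<nu> s l) z" .
    qed (use c in simp)
  qed
qed

end
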